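(* Let $\tau\in\mathbb{C}$ with $\operatorname{Im}\tau>0$. For $n=2,3,4,\dots$ we have $$\wp_z(nz,n\tau)=\frac{1}{n^3\prod_{k=1}^{n-1}\wp_z\!\left(\frac{k}{n},\tau\right)}\prod_{k=0}^{n-1}\wp_z\!\left(z+\frac{k}{n},\tau\right)$$ and $$\wp_z(nz,\tau)=C\prod_{k=0}^{n-1}\prod_{j=0}^{n-1}\wp_z\!\left(z+\frac{k}{n}+\frac{j\tau}{n},\tau\right)$$ with $$C^{-1}=n^3\prod_{\substack{0\le k\le n-1,\ 0\le j\le n-1\\ |j|+|k|\neq0}}\wp_z\!\left(\frac{k}{n}+\frac{j\tau}{n},\tau\right).$$
   Context: For $\operatorname{Im}\tau>0$, $\wp(z,\tau)$ denotes the Weierstrass $\wp$-function of the lattice $\{m+n\tau: m,n\in\mathbb{Z}\}$ (i.e. with $2\omega_1=1$, $2\omega_2=\tau$), and $\wp_z(z,\tau)=\frac{d}{dz}\wp(z,\tau)$ is its derivative in the first argument.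
   Formalization: Each identity is asserted only when its normalising product is nonzero, which is proved for all odd n; for even n that product contains ℘_z(1/2,τ)=0, so the stated constants 1/(n³∏…) and C are undefined and nothing is claimed. *)

theory Defs
  imports "HOL-Complex_Analysis.Complex_Analysis"
begin

definition period_lattice :: "complex \<Rightarrow> complex set" where
  "period_lattice \<tau> = {of_int m + of_int n * \<tau> |m n. True}"

text \<open>
  The sum is the unordered one; for \<open>Im \<tau> > 0\<close> it converges absolutely at every \<open>z\<close> outside the
  lattice. At lattice points the value is a junk value (division by zero), and so is the value
  of \<open>wp_z\<close> there.
\<close>

definition wp :: "complex \<Rightarrow> complex \<Rightarrow> complex" where
  "wp z \<tau> = 1 / z ^ 2 + (\<Sum>\<^sub>\<infinity>\<omega>\<in>period_lattice \<tau> - {0}. 1 / (z - \<omega>) ^ 2 - 1 / \<omega> ^ 2)"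

definition wp_z :: "complex \<Rightarrow> complex \<Rightarrow> complex" where
  "wp_z z \<tau> = deriv (\<lambda>w. wp w \<tau>) z"

end

theory Submission
  imports Defs
begin

text \<open>
  Both identities are instances of one statement. Let \<open>\<Lambda>\<close> be the period lattice of the
  right-hand side and let \<open>M\<close> be the one of the left-hand side, both as functions of \<open>z\<close>, so that
  the shifts on the right represent \<open>M / \<Lambda>\<close>. If the index is odd, the zeros and poles of the
  two sides agree with multiplicity, so their quotient is constant by Liouville's theorem, and
  comparing the leading terms \<open>-2 / z ^ 3\<close> at \<open>0\<close> gives the constant. If \<open>n\<close> is even, both products
  of constants contain \<open>\<wp>'(1 / 2) = 0\<close>.

  The zeros of \<open>\<wp>'\<close> are found without counting them: \<open>\<wp>\<close> solves \<open>y'' = 6 y\<^sup>2 + c\<close>. If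
  \<open>\<wp>'(a) = 0\<close>, then \<open>\<wp>(z)\<close> and \<open>\<wp>(2 a - z)\<close> solve the same initial value problem at \<open>a\<close>, so they
  agree, and their poles force \<open>2 a\<close> to be a period. If also \<open>\<wp>''(a) = 0\<close>, then \<open>\<wp>\<close> agrees with the
  constant solution \<open>\<wp>(a)\<close>, which is absurd.
\<close>

section \<open>The period lattice\<close>

lemma period_lattice_0 [simp, intro]: "0 \<in> period_lattice \<tau>"
  unfolding period_lattice_def by (rule CollectI, rule exI[of _ 0], rule exI[of _ 0]) simp

lemma period_lattice_of_int [simp, intro]: "of_int m \<in> period_lattice \<tau>"
  unfolding period_lattice_def by (rule CollectI, rule exI[of _ m], rule exI[of _ 0]) simp

lemma period_lattice_tau [simp, intro]: "\<tau> \<in> period_lattice \<tau>"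
  unfolding period_lattice_def by (rule CollectI, rule exI[of _ 0], rule exI[of _ 1]) simp

lemma period_lattice_1 [simp, intro]: "1 \<in> period_lattice \<tau>"
  using period_lattice_of_int[of 1 \<tau>] by simp

lemma period_lattice_add [intro]:
  assumes "x \<in> period_lattice \<tau>" "y \<in> period_lattice \<tau>"
  shows   "x + y \<in> period_lattice \<tau>"
proof -
  from assms obtain a b c d :: int
    where "x = of_int a + of_int b * \<tau>" "y = of_int c + of_int d * \<tau>"
    unfolding period_lattice_def by blast
  hence "x + y = of_int (a + c) + of_int (b + d) * \<tau>"
    by (simp add: algebra_simps)
  thus ?thesis unfolding period_lattice_def by blast
qed

lemma period_lattice_uminus [intro]:
  assumes "x \<in> period_lattice \<tau>"
  shows   "-x \<in> period_lattice \<tau>"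
proof -
  from assms obtain a b :: int where "x = of_int a + of_int b * \<tau>"
    unfolding period_lattice_def by blast
  hence "-x = of_int (-a) + of_int (-b) * \<tau>"
    by simp
  thus ?thesis unfolding period_lattice_def by blast
qed

lemma period_lattice_uminus_iff [simp]: "-x \<in> period_lattice \<tau> \<longleftrightarrow> x \<in> period_lattice \<tau>"
  using period_lattice_uminus[of x \<tau>] period_lattice_uminus[of "-x" \<tau>] by auto

lemma period_lattice_diff [intro]:
  "x \<in> period_lattice \<tau> \<Longrightarrow> y \<in> period_lattice \<tau> \<Longrightarrow> x - y \<in> period_lattice \<tau>"
  using period_lattice_add[of x \<tau> "-y"] by auto

lemma period_lattice_add_right_iff [simp]:
  "y \<in> period_lattice \<tau> \<Longrightarrow> x + y \<in> period_lattice \<tau> \<longleftrightarrow> x \<in> period_lattice \<tau>"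
  using period_lattice_diff[of "x + y" \<tau> y] by auto

lemma period_lattice_diff_right_iff [simp]:
  "y \<in> period_lattice \<tau> \<Longrightarrow> x - y \<in> period_lattice \<tau> \<longleftrightarrow> x \<in> period_lattice \<tau>"
  using period_lattice_add_right_iff[of y \<tau> "x - y"] by simp

lemma period_lattice_of_nat_mult [intro]:
  "x \<in> period_lattice \<tau> \<Longrightarrow> of_nat k * x \<in> period_lattice \<tau>"
  by (induction k) (auto simp: algebra_simps)

lemma countable_period_lattice: "countable (period_lattice \<tau>)"
proof -
  have "period_lattice \<tau> = (\<lambda>(m, n). of_int m + of_int n * \<tau>) ` (UNIV :: (int \<times> int) set)"
    unfolding period_lattice_def by auto
  thus ?thesis by simp
qed

text \<open>The imaginary part bounds the second coordinate, and the real part then bounds the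
  first. This yields both the discreteness of the lattice and the convergence of the lattice
  sums.\<close>

lemma period_lattice_coord_bound:
  assumes "Im \<tau> > 0"
  obtains K where "K > 0" and
    "\<And>m n :: int. max \<bar>real_of_int m\<bar> \<bar>real_of_int n\<bar> \<le> K * norm (of_int m + of_int n * \<tau>)"
proof
  define c where "c = 1 / Im \<tau>"
  have c: "c > 0" using assms by (simp add: c_def)
  define K where "K = 1 + c * (1 + \<bar>Re \<tau>\<bar>)"
  show "K > 0" unfolding K_def using c by (simp add: add_pos_nonneg)
  fix m n :: int
  define z where "z = of_int m + of_int n * \<tau>"
  have "\<bar>real_of_int n\<bar> = c * \<bar>Im z\<bar>"
    using assms by (simp add: z_def c_def abs_mult)
  also have "\<dots> \<le> c * norm z"
    using c abs_Im_le_cmod[of z] by simp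
  finally have n: "\<bar>real_of_int n\<bar> \<le> c * norm z" .
  have "real_of_int m = Re z - real_of_int n * Re \<tau>"
    by (simp add: z_def)
  hence "\<bar>real_of_int m\<bar> \<le> \<bar>Re z\<bar> + \<bar>real_of_int n\<bar> * \<bar>Re \<tau>\<bar>"
    by (metis abs_mult abs_triangle_ineq4)
  also have "\<dots> \<le> norm z + c * norm z * \<bar>Re \<tau>\<bar>"
    using n abs_Re_le_cmod[of z] by (intro add_mono mult_right_mono) auto
  finally have m: "\<bar>real_of_int m\<bar> \<le> norm z + c * norm z * \<bar>Re \<tau>\<bar>" .
  have "c * norm z * \<bar>Re \<tau>\<bar> \<ge> 0" "c * norm z \<ge> 0" "norm z \<ge> 0"
    using c by auto
  with m n show "max \<bar>real_of_int m\<bar> \<bar>real_of_int n\<bar> \<le> K * norm (of_int m + of_int n * \<tau>)"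
    unfolding z_def[symmetric] K_def by (simp add: algebra_simps)
qed

lemma period_lattice_inj:
  assumes "Im \<tau> > 0"
  shows   "inj (\<lambda>(m :: int, n :: int). of_int m + of_int n * \<tau>)"
proof (rule injI, clarify)
  fix a b c d :: int
  assume eq: "of_int a + of_int b * \<tau> = of_int c + of_int d * \<tau>"
  from arg_cong[OF eq, of Im] assms have "b = d" by simp
  with eq show "a = c \<and> b = d" by simp
qed

text \<open>Coordinates with respect to \<open>1\<close> and \<open>\<tau>\<close> are unique, so
  divisibility can be read off in each of them. This decides which \<open>n\<close>-division points
  are periods.\<close>

lemma period_lattice_div_iff:
  assumes \<tau>: "Im \<tau> > 0" and n: "n > 0"
  shows "(of_int a + of_int b * \<tau>) / of_nat n \<in> period_lattice \<tau> \<longleftrightarrow> int n dvd a \<and> int n dvd b"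
proof
  assume "(of_int a + of_int b * \<tau>) / of_nat n \<in> period_lattice \<tau>"
  then obtain k l :: int where "(of_int a + of_int b * \<tau>) / of_nat n = of_int k + of_int l * \<tau>"
    unfolding period_lattice_def by blast
  hence "of_int a + of_int b * \<tau> = of_int (int n * k) + of_int (int n * l) * \<tau>"
    using n by (simp add: field_simps)
  with injD[OF period_lattice_inj[OF \<tau>], of "(a, b)" "(int n * k, int n * l)"]
  show "int n dvd a \<and> int n dvd b" by simp
next
  assume "int n dvd a \<and> int n dvd b"
  then obtain k l where "a = int n * k" "b = int n * l" by (auto elim!: dvdE)
  hence "(of_int a + of_int b * \<tau>) / of_nat n = of_int k + of_int l * \<tau>"
    using n by (simp add: field_simps)
  thus "(of_int a + of_int b * \<tau>) / of_nat n \<in> period_lattice \<tau>"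
    unfolding period_lattice_def by blast
qed

lemma period_lattice_norm_ge:
  assumes "Im \<tau> > 0"
  obtains \<epsilon> where "\<epsilon> > 0" "\<And>\<omega>. \<omega> \<in> period_lattice \<tau> \<Longrightarrow> \<omega> \<noteq> 0 \<Longrightarrow> norm \<omega> \<ge> \<epsilon>"
proof -
  obtain K where K: "K > 0"
    "\<And>m n :: int. max \<bar>real_of_int m\<bar> \<bar>real_of_int n\<bar> \<le> K * norm (of_int m + of_int n * \<tau>)"
    using period_lattice_coord_bound[OF assms] by blast
  have "norm \<omega> \<ge> 1 / K" if "\<omega> \<in> period_lattice \<tau>" "\<omega> \<noteq> 0" for \<omega>
  proof -
    from that obtain m n :: int where mn: "\<omega> = of_int m + of_int n * \<tau>"
      unfolding period_lattice_def by blast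
    with that have "m \<noteq> 0 \<or> n \<noteq> 0" by auto
    hence "1 \<le> max \<bar>real_of_int m\<bar> \<bar>real_of_int n\<bar>" by (auto simp: max_def)
    also have "\<dots> \<le> K * norm \<omega>" using K(2)[of m n] mn by simp
    finally show ?thesis using K(1) by (simp add: field_simps)
  qed
  with K(1) show ?thesis using that[of "1 / K"] by simp
qed

text \<open>Distinct periods keep a fixed distance. Arbitrary subsets are allowed in order to cover
  the lattice with one point removed.\<close>

lemma closed_subset_period_lattice:
  assumes "Im \<tau> > 0" "A \<subseteq> period_lattice \<tau>"
  shows   "closed A"
proof -
  obtain \<epsilon> where \<epsilon>: "\<epsilon> > 0" "\<And>\<omega>. \<omega> \<in> period_lattice \<tau> \<Longrightarrow> \<omega> \<noteq> 0 \<Longrightarrow> norm \<omega> \<ge> \<epsilon>"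
    using period_lattice_norm_ge[OF assms(1)] by blast
  show ?thesis
  proof (rule discrete_imp_closed[OF \<epsilon>(1)], intro ballI impI)
    fix x y assume xy: "x \<in> A" "y \<in> A" "dist y x < \<epsilon>"
    show "y = x"
    proof (rule ccontr)
      assume "y \<noteq> x"
      hence "norm (y - x) \<ge> \<epsilon>" using xy assms(2) by (intro \<epsilon>(2)) auto
      thus False using xy by (simp add: dist_norm)
    qed
  qed
qed

section \<open>Convergence of the lattice sum of inverse cubes\<close>

lemma summable_on_int_weight:
  "(\<lambda>m :: int. max 1 \<bar>real_of_int m\<bar> powr (-3/2)) summable_on UNIV"
proof -
  \<comment> \<open>The \<open>max 1\<close> keeps the weight positive at \<open>m = 0\<close>,
    where \<open>0 powr (-3/2)\<close> would be \<open>0\<close>.\<close>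
  let ?w = "\<lambda>m :: int. max 1 \<bar>real_of_int m\<bar> powr (-3/2)"
  have "summable (\<lambda>k :: nat. max 1 (real k) powr (-3/2))"
  proof (rule summable_cong[THEN iffD1])
    show "summable (\<lambda>k :: nat. real k powr (-3/2))"
      by (subst summable_real_powr_iff) simp
    show "eventually (\<lambda>k :: nat. real k powr (-3/2) = max 1 (real k) powr (-3/2)) sequentially"
      using eventually_ge_at_top[of 1] by eventually_elim (simp add: max_def)
  qed
  hence nat: "(\<lambda>k :: nat. max 1 (real k) powr (-3/2)) summable_on UNIV"
    by (subst summable_on_UNIV_nonneg_real_iff) auto
  have "?w summable_on range int"
    by (subst summable_on_reindex) (use nat in \<open>auto simp: o_def\<close>)
  moreover have "?w summable_on range (\<lambda>k. - int k)"
    by (subst summable_on_reindex) (use nat in \<open>auto simp: o_def inj_on_def\<close>)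
  hence "?w summable_on range (\<lambda>k. - int k) - range int"
    by (rule summable_on_subset_banach) auto
  ultimately have "?w summable_on range int \<union> (range (\<lambda>k. - int k) - range int)"
    by (intro summable_on_Un_disjoint) auto
  moreover have "range int \<union> (range (\<lambda>k. - int k) - range int) = UNIV"
    by (auto simp: image_iff) (metis int_cases2)
  ultimately show ?thesis by simp
qed

text \<open>
  If \<open>M\<close> is the maximum of the two coordinates, then \<open>M ^ 3\<close> dominates the product of the
  \<open>3/2\<close>-th powers of the coordinates, which reduces the double series to a product of two
  convergent single ones.
\<close>

lemma summable_on_period_lattice:
  assumes "Im \<tau> > 0"
  shows   "(\<lambda>\<omega>. 1 / norm \<omega> ^ 3) summable_on (period_lattice \<tau> - {0})"
proof -
  let ?w = "\<lambda>m :: int. max 1 \<bar>real_of_int m\<bar>"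
  let ?f = "\<lambda>(m :: int, n :: int). of_int m + of_int n * \<tau>"
  obtain K where K: "K > 0"
    "\<And>m n :: int. max \<bar>real_of_int m\<bar> \<bar>real_of_int n\<bar> \<le> K * norm (of_int m + of_int n * \<tau>)"
    using period_lattice_coord_bound[OF assms] by blast
  have S: "(\<lambda>(m, n). ?w m powr (-3/2) * ?w n powr (-3/2)) summable_on (UNIV \<times> UNIV)"
  proof (rule summable_on_SigmaI)
    show "((\<lambda>n. case (m, n) of (m, n) \<Rightarrow> ?w m powr (-3/2) * ?w n powr (-3/2)) has_sum
            ?w m powr (-3/2) * infsum (\<lambda>n. ?w n powr (-3/2)) UNIV) UNIV" for m
      using has_sum_cmult_right[OF has_sum_infsum[OF summable_on_int_weight], of "?w m powr (-3/2)"]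
      by simp
    show "(\<lambda>m. ?w m powr (-3/2) * infsum (\<lambda>n. ?w n powr (-3/2)) UNIV) summable_on UNIV"
      by (intro summable_on_cmult_left summable_on_int_weight)
  qed auto
  define X where "X = (UNIV :: (int \<times> int) set) - {(0, 0)}"
  have img: "period_lattice \<tau> - {0} = ?f ` X"
  proof -
    have "period_lattice \<tau> = range ?f" unfolding period_lattice_def by auto
    also have "\<dots> - {0} = ?f ` X"
      using image_set_diff[OF period_lattice_inj[OF assms], of UNIV "{(0, 0)}"] by (simp add: X_def)
    finally show ?thesis .
  qed
  have "(\<lambda>p. K ^ 3 * (case p of (m, n) \<Rightarrow> ?w m powr (-3/2) * ?w n powr (-3/2))) summable_on X"
    by (rule summable_on_subset_banach[of _ UNIV])
       (use S in \<open>auto intro!: summable_on_cmult_right\<close>)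
  hence "(\<lambda>p. 1 / norm (?f p) ^ 3) summable_on X"
  proof (rule summable_on_comparison_test)
    fix p assume p: "p \<in> X"
    obtain m n where mn: "p = (m, n)" by force
    define N where "N = norm (of_int m + of_int n * \<tau>)"
    have "m \<noteq> 0 \<or> n \<noteq> 0" using p mn by (auto simp: X_def)
    hence "1 \<le> max \<bar>real_of_int m\<bar> \<bar>real_of_int n\<bar>" by (auto simp: max_def)
    with K(2)[of m n] have le: "?w m \<le> K * N" "?w n \<le> K * N" by (auto simp: N_def)
    have "K * N > 0" using le(1) by linarith
    hence N: "N > 0" using K(1) by (simp add: zero_less_mult_iff)
    \<comment> \<open>The negative exponent reverses the two bounds by \<open>K * N\<close>.\<close>
    have "(K * N) powr (-3/2) \<le> ?w m powr (-3/2)" "(K * N) powr (-3/2) \<le> ?w n powr (-3/2)"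
      using le by (intro powr_mono2'; simp)+
    hence "(K * N) powr (-3/2) * (K * N) powr (-3/2) \<le> ?w m powr (-3/2) * ?w n powr (-3/2)"
      by (intro mult_mono) auto
    also have "(K * N) powr (-3/2) * (K * N) powr (-3/2) = (K * N) powr (-real 3)"
      by (simp flip: powr_add)
    also have "\<dots> = 1 / (K * N) ^ 3"
      using \<open>K * N > 0\<close> by (subst powr_minus_divide, subst powr_realpow) auto
    finally have "1 / (K * N) ^ 3 \<le> ?w m powr (-3/2) * ?w n powr (-3/2)" .
    hence "K ^ 3 * (1 / (K * N) ^ 3) \<le> K ^ 3 * (?w m powr (-3/2) * ?w n powr (-3/2))"
      using K(1) by (intro mult_left_mono) auto
    also have "K ^ 3 * (1 / (K * N) ^ 3) = 1 / N ^ 3"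
      using K(1) N by (simp add: power_mult_distrib)
    finally show "1 / norm (?f p) ^ 3 \<le>
        K ^ 3 * (case p of (m, n) \<Rightarrow> ?w m powr (-3/2) * ?w n powr (-3/2))"
      by (simp add: mn N_def)
  qed auto
  thus ?thesis
    unfolding img
    by (subst summable_on_reindex)
       (auto simp: o_def intro: inj_on_subset[OF period_lattice_inj[OF assms]])
qed

section \<open>Convergence and periodicity of the Weierstrass series\<close>

text \<open>The part of \<open>wp\<close> that stays regular at \<open>0\<close>, split off so that
  principal parts become explicit.\<close>

definition wp_reg :: "complex \<Rightarrow> complex \<Rightarrow> complex" where
  "wp_reg z \<tau> = (\<Sum>\<^sub>\<infinity>\<omega>\<in>period_lattice \<tau> - {0}. 1 / (z - \<omega>) ^ 2 - 1 / \<omega> ^ 2)"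

text \<open>The termwise derivative. At a period the singular term is \<open>- 2 / 0 = 0\<close>, so
  periodicity and oddness hold at every point, which is not clear for the junk values of
  \<open>wp_z\<close>.\<close>

definition wp_z_series :: "complex \<Rightarrow> complex \<Rightarrow> complex" where
  "wp_z_series z \<tau> = (\<Sum>\<^sub>\<infinity>\<omega>\<in>period_lattice \<tau>. - 2 / (z - \<omega>) ^ 3)"

lemma wp_eq: "wp z \<tau> = 1 / z ^ 2 + wp_reg z \<tau>"
  by (simp add: wp_def wp_reg_def)

text \<open>Over the common denominator the numerator is only \<open>z * (2 * \<omega> - z)\<close>.
  Since \<open>norm \<omega>\<close> is at most \<open>1 + \<rho> / \<delta>\<close> times
  \<open>norm (z - \<omega>)\<close>, the term decays like an inverse cube, with one constant for
  near and distant periods.\<close>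

lemma wp_reg_term_bound:
  fixes z \<omega> :: complex
  assumes "\<delta> > 0" "norm z \<le> \<rho>" "norm (z - \<omega>) \<ge> \<delta>" "\<omega> \<noteq> 0"
  shows   "norm (1 / (z - \<omega>) ^ 2 - 1 / \<omega> ^ 2) \<le> 2 * (1 + \<rho> / \<delta>) ^ 2 * \<rho> * (1 / norm \<omega> ^ 3)"
proof -
  define A where "A = 1 + \<rho> / \<delta>"
  define d where "d = norm (z - \<omega>)"
  have \<rho>: "\<rho> \<ge> 0" using assms(2) norm_ge_zero[of z] by linarith
  have A: "A \<ge> 1" using assms(1) \<rho> by (simp add: A_def)
  have d: "d > 0" "d \<ge> \<delta>" using assms by (auto simp: d_def)
  have nz: "z - \<omega> \<noteq> 0" using d by (auto simp: d_def)
  have "\<rho> = \<delta> * (\<rho> / \<delta>)" using assms(1) by simp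
  also have "\<dots> \<le> d * (\<rho> / \<delta>)" using d assms(1) \<rho> by (intro mult_right_mono) auto
  finally have "d + \<rho> \<le> d * A" by (simp add: A_def algebra_simps)
  have "norm \<omega> \<le> norm (z - \<omega>) + norm z"
    using norm_triangle_ineq4[of z "z - \<omega>"] by simp
  hence \<omega>: "norm \<omega> \<le> d * A" using \<open>d + \<rho> \<le> d * A\<close> assms(2) by (simp add: d_def)
  have "2 * \<omega> - z = z - 2 * (z - \<omega>)" by simp
  also have "norm \<dots> \<le> norm z + 2 * d"
    using norm_triangle_ineq4[of z "2 * (z - \<omega>)"] by (simp only: d_def norm_mult) simp
  also have "\<dots> \<le> 2 * (d * A)"
    using \<open>d + \<rho> \<le> d * A\<close> assms(2) \<rho> by linarith
  finally have *: "norm (2 * \<omega> - z) \<le> 2 * (d * A)" .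
  have "1 / (z - \<omega>) ^ 2 - 1 / \<omega> ^ 2 = z * (2 * \<omega> - z) / ((z - \<omega>) ^ 2 * \<omega> ^ 2)"
    using nz assms(4) by (simp add: divide_simps) (simp add: power2_eq_square algebra_simps)
  also have "norm \<dots> = norm z * norm (2 * \<omega> - z) / (d ^ 2 * norm \<omega> ^ 2)"
    by (simp add: norm_mult norm_divide norm_power d_def)
  also have "\<dots> \<le> \<rho> * (2 * (d * A)) / (d ^ 2 * norm \<omega> ^ 2)"
    using * assms(2) \<rho> by (intro divide_right_mono mult_mono) auto
  also have "\<dots> = 2 * A * \<rho> / norm \<omega> ^ 3 * (norm \<omega> / d)"
    using d assms(4) by (simp add: field_simps power2_eq_square power3_eq_cube)
  also have "norm \<omega> / d \<le> A" using \<omega> d by (simp add: field_simps)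
  hence "2 * A * \<rho> / norm \<omega> ^ 3 * (norm \<omega> / d) \<le> 2 * A * \<rho> / norm \<omega> ^ 3 * A"
    using A \<rho> by (intro mult_left_mono) auto
  also have "\<dots> = 2 * A ^ 2 * \<rho> * (1 / norm \<omega> ^ 3)"
    by (simp add: power2_eq_square)
  finally show ?thesis unfolding A_def .
qed

lemma has_field_derivative_inverse_square:
  fixes y :: complex
  assumes "y \<noteq> 0"
  shows   "((\<lambda>y. 1 / y ^ 2) has_field_derivative - 2 / y ^ 3) (at y)"
  using assms
  by (auto intro!: derivative_eq_intros simp: field_simps power2_eq_square power3_eq_cube)

text \<open>The finite partial sums converge uniformly near \<open>z\<close> by the Weierstrass
  test, so differentiation may be done term by term. The point \<open>z = 0\<close> is
  included.\<close>

lemma wp_reg_deriv: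
  assumes \<tau>: "Im \<tau> > 0" and z: "z \<notin> period_lattice \<tau> - {0}"
  obtains D where "((\<lambda>w. wp_reg w \<tau>) has_field_derivative D) (at z)"
    "((\<lambda>\<omega>. - 2 / (z - \<omega>) ^ 3) has_sum D) (period_lattice \<tau> - {0})"
proof -
  let ?L = "period_lattice \<tau> - {0}"
  have "closed ?L" by (rule closed_subset_period_lattice[OF \<tau>]) auto
  then obtain e where e: "e > 0" "ball z e \<subseteq> -?L"
    using z by (metis ComplI open_Compl openE)
  \<comment> \<open>With half the radius, the whole closed ball stays at distance at least
    \<open>r\<close> from \<open>?L\<close>.\<close>
  define r where "r = e / 2"
  define \<rho> where "\<rho> = norm z + r"
  have r: "r > 0" using e by (simp add: r_def)
  have dist: "norm (w - \<omega>) \<ge> r" if "w \<in> cball z r" "\<omega> \<in> ?L" for w \<omega>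
  proof -
    have "\<omega> \<notin> ball z e" using that(2) e by blast
    hence "e \<le> dist z \<omega>" by simp
    also have "\<dots> \<le> dist z w + dist w \<omega>" by (rule dist_triangle)
    finally show ?thesis using that(1) by (simp add: r_def dist_norm)
  qed
  have bound: "norm (1 / (w - \<omega>) ^ 2 - 1 / \<omega> ^ 2) \<le> 2 * (1 + \<rho> / r) ^ 2 * \<rho> * (1 / norm \<omega> ^ 3)"
    if "\<omega> \<in> ?L" "w \<in> cball z r" for \<omega> w
  proof (rule wp_reg_term_bound[OF r])
    have "norm w \<le> norm z + norm (w - z)" by (metis norm_triangle_sub)
    thus "norm w \<le> \<rho>" using that(2) by (simp add: \<rho>_def dist_norm norm_minus_commute)
  qed (use that dist in auto)
  have ulim: "uniform_limit (cball z r) (\<lambda>X w. \<Sum>\<omega>\<in>X. 1 / (w - \<omega>) ^ 2 - 1 / \<omega> ^ 2)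
                (\<lambda>w. wp_reg w \<tau>) (finite_subsets_at_top ?L)"
    unfolding wp_reg_def
    by (rule Weierstrass_m_test_general[OF bound], assumption, assumption)
       (intro summable_on_cmult_right summable_on_period_lattice[OF \<tau>])
  have der: "((\<lambda>w. \<Sum>\<omega>\<in>X. 1 / (w - \<omega>) ^ 2 - 1 / \<omega> ^ 2) has_field_derivative
               (\<Sum>\<omega>\<in>X. - 2 / (w - \<omega>) ^ 3)) (at w)"
    if "X \<subseteq> ?L" "w \<in> cball z r" for X w
  proof (rule DERIV_sum)
    fix \<omega> assume "\<omega> \<in> X"
    hence "w - \<omega> \<noteq> 0" using dist[OF that(2) subsetD[OF that(1)], of \<omega>] r by auto
    moreover have "((\<lambda>w. w - \<omega>) has_field_derivative 1) (at w)"
      by (auto intro!: derivative_eq_intros)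
    ultimately have "((\<lambda>w. 1 / (w - \<omega>) ^ 2) has_field_derivative - 2 / (w - \<omega>) ^ 3 * 1) (at w)"
      by (rule DERIV_chain2[where g = "\<lambda>w. w - \<omega>", OF has_field_derivative_inverse_square])
    from DERIV_diff[OF this DERIV_const]
    show "((\<lambda>w. 1 / (w - \<omega>) ^ 2 - 1 / \<omega> ^ 2) has_field_derivative - 2 / (w - \<omega>) ^ 3) (at w)"
      by (simp only: diff_0_right mult_1_right)
  qed
  have "eventually (\<lambda>X. continuous_on (cball z r) (\<lambda>w. \<Sum>\<omega>\<in>X. 1 / (w - \<omega>) ^ 2 - 1 / \<omega> ^ 2) \<and>
          (\<forall>w\<in>ball z r. ((\<lambda>w. \<Sum>\<omega>\<in>X. 1 / (w - \<omega>) ^ 2 - 1 / \<omega> ^ 2) has_field_derivative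
               (\<Sum>\<omega>\<in>X. - 2 / (w - \<omega>) ^ 3)) (at w))) (finite_subsets_at_top ?L)"
  proof (rule eventually_finite_subsets_at_top_weakI)
    fix X assume X: "finite X" "X \<subseteq> ?L"
    show "continuous_on (cball z r) (\<lambda>w. \<Sum>\<omega>\<in>X. 1 / (w - \<omega>) ^ 2 - 1 / \<omega> ^ 2) \<and>
          (\<forall>w\<in>ball z r. ((\<lambda>w. \<Sum>\<omega>\<in>X. 1 / (w - \<omega>) ^ 2 - 1 / \<omega> ^ 2) has_field_derivative
               (\<Sum>\<omega>\<in>X. - 2 / (w - \<omega>) ^ 3)) (at w))"
    proof (intro conjI ballI)
      show "continuous_on (cball z r) (\<lambda>w. \<Sum>\<omega>\<in>X. 1 / (w - \<omega>) ^ 2 - 1 / \<omega> ^ 2)"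
        by (rule DERIV_continuous_on[OF has_field_derivative_at_within[OF der[OF X(2)]]])
    qed (rule der[OF X(2)], simp)
  qed
  from has_complex_derivative_uniform_limit[OF this ulim _ r]
  obtain g' where g': "\<And>w. w \<in> ball z r \<Longrightarrow> ((\<lambda>w. wp_reg w \<tau>) has_field_derivative g' w) (at w) \<and>
      ((\<lambda>X. \<Sum>\<omega>\<in>X. - 2 / (w - \<omega>) ^ 3) \<longlongrightarrow> g' w) (finite_subsets_at_top ?L)"
    by auto
  show ?thesis
    using that[of "g' z"] g'[of z] r by (auto simp: has_sum_def)
qed

lemma wp_reg_holomorphic:
  assumes "Im \<tau> > 0"
  shows   "(\<lambda>z. wp_reg z \<tau>) holomorphic_on (- (period_lattice \<tau> - {0}))"
proof (rule holomorphic_onI)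
  fix z assume "z \<in> - (period_lattice \<tau> - {0})"
  then obtain D where "((\<lambda>w. wp_reg w \<tau>) has_field_derivative D) (at z)"
    using wp_reg_deriv[OF assms, of z] by auto
  thus "(\<lambda>z. wp_reg z \<tau>) field_differentiable at z within - (period_lattice \<tau> - {0})"
    by (meson field_differentiable_at_within field_differentiable_def)
qed

lemma wp_reg_analytic:
  assumes "Im \<tau> > 0"
  shows   "(\<lambda>z. wp_reg z \<tau>) analytic_on (- (period_lattice \<tau> - {0}))"
proof (subst analytic_on_open)
  show "open (- (period_lattice \<tau> - {0}))"
    by (intro open_Compl closed_subset_period_lattice[OF assms]) auto
qed (rule wp_reg_holomorphic[OF assms])

lemma wp_reg_0 [simp]: "wp_reg 0 \<tau> = 0"
  by (simp add: wp_reg_def)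

lemma wp_reg_minus: "wp_reg (-z) \<tau> = wp_reg z \<tau>"
  unfolding wp_reg_def
proof (rule infsum_reindex_bij_witness[of _ uminus uminus])
  fix \<omega> :: complex
  have "(z - (- \<omega>)) ^ 2 = (- z - \<omega>) ^ 2" by (simp add: power2_eq_square algebra_simps)
  thus "1 / (z - - \<omega>) ^ 2 - 1 / (- \<omega>) ^ 2 = 1 / (- z - \<omega>) ^ 2 - 1 / \<omega> ^ 2" by simp
qed auto

lemma wp_minus: "wp (-z) \<tau> = wp z \<tau>"
  by (simp add: wp_eq wp_reg_minus)

text \<open>The derivative of \<open>1 / z ^ 2\<close> supplies the missing term for
  \<open>\<omega> = 0\<close>.\<close>

lemma wp_has_field_derivative:
  assumes \<tau>: "Im \<tau> > 0" and z: "z \<notin> period_lattice \<tau>"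
  shows   "((\<lambda>z. wp z \<tau>) has_field_derivative wp_z_series z \<tau>) (at z)"
proof -
  obtain D where D: "((\<lambda>w. wp_reg w \<tau>) has_field_derivative D) (at z)"
    "((\<lambda>\<omega>. - 2 / (z - \<omega>) ^ 3) has_sum D) (period_lattice \<tau> - {0})"
    using wp_reg_deriv[OF \<tau>, of z] z by auto
  from D(2) have "((\<lambda>\<omega>. - 2 / (z - \<omega>) ^ 3) has_sum (- 2 / (z - 0) ^ 3 + D))
      (insert 0 (period_lattice \<tau> - {0}))"
    by (intro has_sum_insert) auto
  also have "insert 0 (period_lattice \<tau> - {0}) = period_lattice \<tau>" by auto
  finally have "wp_z_series z \<tau> = - 2 / z ^ 3 + D"
    unfolding wp_z_series_def by (simp add: infsumI)
  moreover have "z \<noteq> 0" using z by auto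
  ultimately show ?thesis
    unfolding wp_eq
    by (auto intro!: derivative_eq_intros D(1) simp: field_simps power2_eq_square power3_eq_cube)
qed

lemma wp_z_eq_series:
  "Im \<tau> > 0 \<Longrightarrow> z \<notin> period_lattice \<tau> \<Longrightarrow> wp_z z \<tau> = wp_z_series z \<tau>"
  unfolding wp_z_def by (intro DERIV_imp_deriv wp_has_field_derivative)

lemma wp_holomorphic:
  assumes "Im \<tau> > 0"
  shows   "(\<lambda>z. wp z \<tau>) holomorphic_on (- period_lattice \<tau>)"
proof (rule holomorphic_onI)
  fix z assume "z \<in> - period_lattice \<tau>"
  thus "(\<lambda>z. wp z \<tau>) field_differentiable at z within - period_lattice \<tau>"
    using wp_has_field_derivative[OF assms, of z]
    by (meson ComplD field_differentiable_at_within field_differentiable_def)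
qed

lemma wp_z_series_period:
  assumes "\<omega> \<in> period_lattice \<tau>"
  shows   "wp_z_series (z + \<omega>) \<tau> = wp_z_series z \<tau>"
  unfolding wp_z_series_def
  by (rule infsum_reindex_bij_witness[of _ "\<lambda>x. x + \<omega>" "\<lambda>x. x - \<omega>"])
     (use assms in \<open>auto simp: algebra_simps\<close>)

lemma wp_z_series_minus: "wp_z_series (-z) \<tau> = - wp_z_series z \<tau>"
proof -
  have "wp_z_series (-z) \<tau> = (\<Sum>\<^sub>\<infinity>\<omega>\<in>period_lattice \<tau>. (-1) * (- 2 / (z - \<omega>) ^ 3))"
    unfolding wp_z_series_def
  proof (rule infsum_reindex_bij_witness[of _ uminus uminus])
    fix \<omega> :: complex
    have "(- z - \<omega>) ^ 3 = - ((z - (- \<omega>)) ^ 3)" by (simp add: power3_eq_cube algebra_simps)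
    thus "- 1 * (- 2 / (z - - \<omega>) ^ 3) = - 2 / (- z - \<omega>) ^ 3" by simp
  qed auto
  also have "\<dots> = - wp_z_series z \<tau>"
    unfolding wp_z_series_def by (subst infsum_cmult_right') simp
  finally show ?thesis .
qed

section \<open>Periodicity of the Weierstrass function\<close>

lemma connected_compl_countable: "countable A \<Longrightarrow> connected (- A :: complex set)"
  using connected_open_diff_countable[of "UNIV :: complex set" A] by (simp add: Compl_eq_Diff_UNIV connected_UNIV)

lemma open_compl_period_lattice: "Im \<tau> > 0 \<Longrightarrow> open (- period_lattice \<tau>)"
  using closed_subset_period_lattice[of \<tau> "period_lattice \<tau>"] by (simp add: open_Compl)

text \<open>
  The difference \<open>\<wp>(z + \<omega>) - \<wp>(z)\<close> has derivative \<open>0\<close>, and it vanishes at \<open>z = -\<omega> / 2\<close>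
  because \<open>\<wp>\<close> is even; this needs \<open>\<omega> / 2\<close> to be outside of the lattice.
\<close>

lemma wp_period_half:
  assumes \<tau>: "Im \<tau> > 0" and \<omega>: "\<omega> \<in> period_lattice \<tau>" "\<omega> / 2 \<notin> period_lattice \<tau>"
    and z: "z \<notin> period_lattice \<tau>"
  shows   "wp (z + \<omega>) \<tau> = wp z \<tau>"
proof -
  let ?L = "period_lattice \<tau>"
  have "(\<lambda>z. wp (z + \<omega>) \<tau> - wp z \<tau>) constant_on (- ?L)"
  proof (rule has_field_derivative_0_imp_constant_on)
    fix z assume z: "z \<in> - ?L"
    hence "z + \<omega> \<notin> ?L" using \<omega> by simp
    from wp_has_field_derivative[OF \<tau> this]
    have "((\<lambda>z. wp (z + \<omega>) \<tau>) has_field_derivative wp_z_series (z + \<omega>) \<tau>) (at z)"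
      by (simp add: DERIV_shift)
    moreover have "((\<lambda>z. wp z \<tau>) has_field_derivative wp_z_series z \<tau>) (at z)"
      using wp_has_field_derivative[OF \<tau>, of z] z by simp
    ultimately show "((\<lambda>z. wp (z + \<omega>) \<tau> - wp z \<tau>) has_field_derivative 0) (at z)"
      using wp_z_series_period[OF \<omega>(1), of z] by (auto intro!: derivative_eq_intros)
  qed (auto simp: connected_compl_countable countable_period_lattice open_compl_period_lattice \<tau>)
  then obtain c where c: "\<And>z. z \<in> - ?L \<Longrightarrow> wp (z + \<omega>) \<tau> - wp z \<tau> = c"
    unfolding constant_on_def by blast
  have "-\<omega> / 2 \<in> - ?L" using \<omega>(2) period_lattice_uminus_iff[of "\<omega> / 2" \<tau>] by simp
  from c[OF this] have "c = 0" using wp_minus[of "\<omega> / 2" \<tau>] by (simp add: field_simps)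
  with c[of z] z show ?thesis by simp
qed

text \<open>Neither \<open>1 / 2\<close> nor \<open>\<tau> / 2\<close> is a period, so the preceding
  lemma applies to both generators, and induction on the coordinates gives the rest.\<close>

lemma wp_period:
  assumes \<tau>: "Im \<tau> > 0" and \<omega>: "\<omega> \<in> period_lattice \<tau>" and z: "z \<notin> period_lattice \<tau>"
  shows   "wp (z + \<omega>) \<tau> = wp z \<tau>"
proof -
  have 1: "1 / 2 \<notin> period_lattice \<tau>" and 2: "\<tau> / 2 \<notin> period_lattice \<tau>"
    using period_lattice_div_iff[OF \<tau>, of 2 1 0] period_lattice_div_iff[OF \<tau>, of 2 0 1] by auto
  have int: "\<forall>z. z \<notin> period_lattice \<tau> \<longrightarrow> wp (z + of_int k * a) \<tau> = wp z \<tau>"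
    if a: "a \<in> period_lattice \<tau>" "a / 2 \<notin> period_lattice \<tau>" for a and k :: int
  proof (induction k rule: int_induct[of _ 0])
    case (step1 i)
    show ?case
    proof (intro allI impI)
      fix z assume z: "z \<notin> period_lattice \<tau>"
      have "wp (z + a + of_int i * a) \<tau> = wp (z + a) \<tau>"
        using step1 a(1) z by auto
      also have "\<dots> = wp z \<tau>" using wp_period_half[OF \<tau> a z] .
      finally show "wp (z + of_int (i + 1) * a) \<tau> = wp z \<tau>" by (simp add: algebra_simps)
    qed
  next
    case (step2 i)
    show ?case
    proof (intro allI impI)
      fix z assume z: "z \<notin> period_lattice \<tau>"
      have "wp (z - a + of_int i * a) \<tau> = wp (z - a) \<tau>"
        using step2 a(1) z by auto
      also have "\<dots> = wp z \<tau>"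
        using wp_period_half[OF \<tau> a, of "z - a"] a(1) z by auto
      finally show "wp (z + of_int (i - 1) * a) \<tau> = wp z \<tau>" by (simp add: algebra_simps)
    qed
  qed auto
  from \<omega> obtain m n :: int where mn: "\<omega> = of_int m + of_int n * \<tau>"
    unfolding period_lattice_def by blast
  have "wp (z + of_int m + of_int n * \<tau>) \<tau> = wp (z + of_int m) \<tau>"
    using int[of \<tau> n] 2 z by auto
  also have "\<dots> = wp z \<tau>" using int[of 1 m] 1 z by auto
  finally show ?thesis by (simp add: mn add_ac)
qed

section \<open>The differential equation\<close>

lemma eventually_notin_period_lattice:
  assumes "Im \<tau> > 0"
  shows   "eventually (\<lambda>w. w \<notin> period_lattice \<tau>) (at z)"
proof -
  have "open (- (period_lattice \<tau> - {z}))"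
    by (intro open_Compl closed_subset_period_lattice[OF assms]) auto
  hence "eventually (\<lambda>w. w \<in> - (period_lattice \<tau> - {z}) - {z}) (at z)"
    by (intro eventually_at_in_open) auto
  thus ?thesis by eventually_elim auto
qed

text \<open>Removing the singularities gives an entire periodic function. It takes all its values on
  a compact parallelogram, so it is bounded and therefore constant. Limits are used throughout
  because \<open>f\<close> may have arbitrary values at its singularities.\<close>

lemma elliptic_liouville:
  assumes \<tau>: "Im \<tau> > 0" and mero: "f meromorphic_on UNIV"
    and lim: "\<And>z. \<exists>c. (f \<longlongrightarrow> c) (at z)"
    and per: "\<And>z \<omega>. \<omega> \<in> period_lattice \<tau> \<Longrightarrow> eventually (\<lambda>w. f (w + \<omega>) = f w) (at z)"
  obtains c where "\<And>z. (f \<longlongrightarrow> c) (at z)"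
proof -
  define g where "g = remove_sings f"
  have g: "(f \<longlongrightarrow> g z) (at z)" for z
    using lim[of z] remove_sings_eqI unfolding g_def by blast
  have "g analytic_on {z}" for z
    unfolding g_def
    by (rule remove_sings_analytic_at[OF meromorphic_on_isolated_singularity g])
       (rule meromorphic_on_subset[OF mero], simp)
  hence holo: "g holomorphic_on UNIV"
    using analytic_on_analytic_at analytic_imp_holomorphic by blast
  \<comment> \<open>The periodicity of \<open>f\<close> is known on punctured neighbourhoods only
    and passes to \<open>g\<close> through limits.\<close>
  have period: "g (z + \<omega>) = g z" if "\<omega> \<in> period_lattice \<tau>" for z \<omega>
  proof -
    have "((\<lambda>w. f (w + \<omega>)) \<longlongrightarrow> g (z + \<omega>)) (at z)"
      using LIM_offset[OF g[of "z + \<omega>"], of \<omega>] by simp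
    hence "(f \<longlongrightarrow> g (z + \<omega>)) (at z)"
      using filterlim_cong[OF refl refl per[OF that, of z]] by blast
    thus ?thesis using g tendsto_unique[OF at_neq_bot] by blast
  qed
  define K where "K = (\<lambda>(x, y). of_real x + of_real y * \<tau>) ` ({0..1} \<times> {0..1})"
  have "compact K" unfolding K_def
    by (intro compact_continuous_image compact_Times compact_Icc)
       (auto simp: case_prod_unfold intro!: continuous_intros)
  have "range g \<subseteq> g ` K"
  proof safe
    fix z
    define y where "y = Im z / Im \<tau>"
    define x where "x = Re z - y * Re \<tau>"
    have z: "z = of_real x + of_real y * \<tau>"
      using \<tau> by (simp add: complex_eq_iff x_def y_def)
    \<comment> \<open>Removing the integer parts of both real coordinates moves \<open>z\<close>
      into the parallelogram.\<close>
    define \<omega> where "\<omega> = - (of_int \<lfloor>x\<rfloor> + of_int \<lfloor>y\<rfloor> * \<tau>)"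
    have "\<omega> \<in> period_lattice \<tau>"
      unfolding \<omega>_def period_lattice_uminus_iff unfolding period_lattice_def by blast
    hence "g z = g (z + \<omega>)" using period by simp
    moreover have "z + \<omega> = of_real (frac x) + of_real (frac y) * \<tau>"
      by (simp add: z \<omega>_def frac_def algebra_simps)
    moreover have "(frac x, frac y) \<in> {0..1} \<times> {0..1}"
      using frac_ge_0[of x] frac_lt_1[of x] frac_ge_0[of y] frac_lt_1[of y] by auto
    ultimately show "g z \<in> g ` K" unfolding K_def by force
  qed
  moreover have "bounded (g ` K)"
    using \<open>compact K\<close> holo
    by (intro compact_imp_bounded compact_continuous_image)
       (auto intro: holomorphic_on_imp_continuous_on holomorphic_on_subset)
  ultimately have "bounded (range g)" by (rule bounded_subset[rotated])
  with Liouville_theorem[OF holo] obtain c where "\<And>z. g z = c"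
    unfolding constant_on_def by auto
  with g that show ?thesis by metis
qed

section \<open>Meromorphy of the function and of its derivative\<close>

lemma wp_meromorphic:
  assumes \<tau>: "Im \<tau> > 0"
  shows   "(\<lambda>z. wp z \<tau>) meromorphic_on UNIV"
proof (subst meromorphic_on_meromorphic_at, safe)
  fix a :: complex
  show "(\<lambda>z. wp z \<tau>) meromorphic_on {a}"
  proof (cases "a \<in> period_lattice \<tau>")
    case False
    have "(\<lambda>z. wp z \<tau>) analytic_on - period_lattice \<tau>"
      using wp_holomorphic[OF \<tau>] open_compl_period_lattice[OF \<tau>] by (simp add: analytic_on_open)
    thus ?thesis
      by (rule analytic_on_imp_meromorphic_on[OF analytic_on_subset]) (use False in auto)
  next
    case True
    \<comment> \<open>The pole is explicit at \<open>0\<close>; periodicity transports it to the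
      period \<open>a\<close>.\<close>
    have "(\<lambda>z. wp_reg z \<tau>) meromorphic_on {0}"
      by (rule analytic_on_imp_meromorphic_on[OF analytic_on_subset[OF wp_reg_analytic[OF \<tau>]]]) auto
    hence "(\<lambda>z. 1 / z ^ 2 + wp_reg z \<tau>) meromorphic_on {0}"
      by (intro meromorphic_intros)
    hence "(\<lambda>w. 1 / (w - a) ^ 2 + wp_reg (w - a) \<tau>) meromorphic_on {a}"
      by (rule meromorphic_on_compose) (auto intro!: analytic_intros)
    also have "?this \<longleftrightarrow> ?thesis"
    proof (rule meromorphic_on_cong)
      fix z assume "z \<in> {a}"
      show "eventually (\<lambda>w. 1 / (w - a) ^ 2 + wp_reg (w - a) \<tau> = wp w \<tau>) (at z)"
        using eventually_notin_period_lattice[OF \<tau>, of z]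
      proof eventually_elim
        case (elim w)
        thus ?case using wp_period[OF \<tau> True, of "w - a"] True by (simp add: wp_eq)
      qed
    qed auto
    finally show ?thesis .
  qed
qed

lemma wp_z_series_eq_deriv:
  "Im \<tau> > 0 \<Longrightarrow> z \<notin> period_lattice \<tau> \<Longrightarrow> wp_z_series z \<tau> = deriv (\<lambda>w. wp w \<tau>) z"
  using DERIV_imp_deriv[OF wp_has_field_derivative] by simp

lemma wp_z_series_meromorphic:
  assumes \<tau>: "Im \<tau> > 0"
  shows   "(\<lambda>z. wp_z_series z \<tau>) meromorphic_on UNIV"
proof -
  have "deriv (\<lambda>z. wp z \<tau>) meromorphic_on UNIV"
    by (intro meromorphic_on_deriv wp_meromorphic \<tau>)
  also have "?this \<longleftrightarrow> ?thesis"
  proof (rule meromorphic_on_cong)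
    fix z
    show "eventually (\<lambda>w. deriv (\<lambda>z. wp z \<tau>) w = wp_z_series w \<tau>) (at z)"
      using eventually_notin_period_lattice[OF \<tau>, of z]
      by eventually_elim (simp add: wp_z_series_eq_deriv[OF \<tau>])
  qed auto
  finally show ?thesis .
qed

lemma wp_z_series_holomorphic:
  assumes \<tau>: "Im \<tau> > 0"
  shows   "(\<lambda>z. wp_z_series z \<tau>) holomorphic_on - period_lattice \<tau>"
proof -
  have "deriv (\<lambda>z. wp z \<tau>) holomorphic_on - period_lattice \<tau>"
    by (intro holomorphic_deriv wp_holomorphic open_compl_period_lattice \<tau>)
  thus ?thesis
    by (rule holomorphic_transform) (simp add: wp_z_series_eq_deriv[OF \<tau>])
qed

lemma wp_z_series_has_field_derivative:
  assumes \<tau>: "Im \<tau> > 0" and z: "z \<notin> period_lattice \<tau>"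
  shows   "((\<lambda>z. wp_z_series z \<tau>) has_field_derivative deriv (\<lambda>w. wp_z_series w \<tau>) z) (at z)"
  using holomorphic_derivI[OF wp_z_series_holomorphic[OF \<tau>] open_compl_period_lattice[OF \<tau>]] z
  by auto

lemma wp_z_series_eq_reg:
  assumes \<tau>: "Im \<tau> > 0" and z: "z \<notin> period_lattice \<tau>"
  shows   "wp_z_series z \<tau> = - 2 / z ^ 3 + deriv (\<lambda>w. wp_reg w \<tau>) z"
proof -
  have "((\<lambda>w. wp_reg w \<tau>) has_field_derivative deriv (\<lambda>w. wp_reg w \<tau>) z) (at z)"
    using wp_reg_deriv[OF \<tau>, of z] z DERIV_deriv_iff_field_differentiable field_differentiable_def
    by (metis DiffD1)
  moreover have "z \<noteq> 0" using z by auto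
  ultimately have "((\<lambda>w. 1 / w ^ 2 + wp_reg w \<tau>) has_field_derivative
      (- 2 / z ^ 3 + deriv (\<lambda>w. wp_reg w \<tau>) z)) (at z)"
    by (auto intro!: derivative_eq_intros simp: field_simps power2_eq_square power3_eq_cube)
  with wp_has_field_derivative[OF assms] show ?thesis
    unfolding wp_eq using DERIV_unique by blast
qed

section \<open>Behaviour at the origin\<close>

lemma wp_reg_isCont_0:
  assumes \<tau>: "Im \<tau> > 0"
  shows "isCont (\<lambda>z. wp_reg z \<tau>) 0" "isCont (deriv (\<lambda>z. wp_reg z \<tau>)) 0"
    "isCont (deriv (deriv (\<lambda>z. wp_reg z \<tau>))) 0"
proof -
  have "(\<lambda>z. wp_reg z \<tau>) analytic_on {0}"
    by (rule analytic_on_subset[OF wp_reg_analytic[OF \<tau>]]) auto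
  thus "isCont (\<lambda>z. wp_reg z \<tau>) 0" "isCont (deriv (\<lambda>z. wp_reg z \<tau>)) 0"
    "isCont (deriv (deriv (\<lambda>z. wp_reg z \<tau>))) 0"
    by (auto intro!: analytic_at_imp_isCont analytic_deriv)
qed

text \<open>This separates \<open>wp\<close> from every function that is regular at
  \<open>0\<close>, for which the same limit is \<open>0\<close>.\<close>

lemma wp_pole_tendsto:
  assumes \<tau>: "Im \<tau> > 0"
  shows   "((\<lambda>z. z ^ 2 * wp z \<tau>) \<longlongrightarrow> 1) (at 0)"
proof -
  have "((\<lambda>z. 1 + z ^ 2 * wp_reg z \<tau>) \<longlongrightarrow> 1 + 0 ^ 2 * wp_reg 0 \<tau>) (at 0)"
    using wp_reg_isCont_0(1)[OF \<tau>] by (intro tendsto_intros) (simp add: isCont_def)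
  also have "?this \<longleftrightarrow> ?thesis"
  proof (rule filterlim_cong)
    show "eventually (\<lambda>z. 1 + z ^ 2 * wp_reg z \<tau> = z ^ 2 * wp z \<tau>) (at 0)"
      using eventually_neq_at_within[of 0] by eventually_elim (simp add: wp_eq field_simps)
  qed auto
  finally show ?thesis .
qed

text \<open>The leading coefficient of the triple pole determines the constants in the product
  formulas.\<close>

lemma wp_z_series_pole_tendsto:
  assumes \<tau>: "Im \<tau> > 0"
  shows   "((\<lambda>z. z ^ 3 * wp_z_series z \<tau>) \<longlongrightarrow> - 2) (at 0)"
proof -
  have "((\<lambda>z. - 2 + z ^ 3 * deriv (\<lambda>w. wp_reg w \<tau>) z) \<longlongrightarrow>
          - 2 + 0 ^ 3 * deriv (\<lambda>w. wp_reg w \<tau>) 0) (at 0)"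
    using wp_reg_isCont_0(2)[OF \<tau>] by (intro tendsto_intros) (simp add: isCont_def)
  also have "?this \<longleftrightarrow> ?thesis"
  proof (rule filterlim_cong)
    show "eventually (\<lambda>z. - 2 + z ^ 3 * deriv (\<lambda>w. wp_reg w \<tau>) z = z ^ 3 * wp_z_series z \<tau>) (at 0)"
      using eventually_notin_period_lattice[OF \<tau>] eventually_neq_at_within[of 0]
      by eventually_elim (simp add: wp_z_series_eq_reg[OF \<tau>] field_simps)
  qed auto
  finally show ?thesis .
qed

text \<open>The regular part of \<open>\<wp>\<close> vanishes to second order at \<open>0\<close>, since it is even.\<close>

lemma wp_reg_div_square_tendsto:
  assumes \<tau>: "Im \<tau> > 0"
  shows   "\<exists>l. ((\<lambda>z. wp_reg z \<tau> / z ^ 2) \<longlongrightarrow> l) (at 0)"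
proof -
  let ?S = "- (period_lattice \<tau> - {0})"
  have S: "open ?S" by (intro open_Compl closed_subset_period_lattice[OF \<tau>]) auto
  have "0 \<in> interior ?S" using S by (simp add: interior_open)
  \<comment> \<open>This is the regular part divided by \<open>z\<close>, with the singularity
    removed. It is odd away from \<open>0\<close>, which forces \<open>g 0 = 0\<close> and permits a
    second division by \<open>z\<close>.\<close>
  define g where "g = (\<lambda>z. if z = 0 then deriv (\<lambda>z. wp_reg z \<tau>) 0
                            else (wp_reg z \<tau> - wp_reg 0 \<tau>) / (z - 0))"
  have g: "g holomorphic_on ?S"
    unfolding g_def by (rule pole_lemma[OF wp_reg_holomorphic[OF \<tau>] \<open>0 \<in> interior ?S\<close>])
  hence cont: "isCont g 0"
    using S by (meson ComplI DiffD2 continuous_on_interior holomorphic_on_imp_continuous_on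
                      \<open>0 \<in> interior ?S\<close>)
  have "eventually (\<lambda>z. g (-z) = - g z) (at 0)"
    using eventually_neq_at_within[of 0]
    by eventually_elim (simp add: g_def wp_reg_minus)
  moreover have "(g \<longlongrightarrow> g 0) (at 0)" using cont by (simp add: isCont_def)
  moreover have "((\<lambda>z. g (-z)) \<longlongrightarrow> g 0) (at 0)"
    using cont by (auto intro!: isCont_tendsto_compose[of 0 g] tendsto_eq_intros)
  ultimately have "((\<lambda>z. - g z) \<longlongrightarrow> g 0) (at 0)" "((\<lambda>z. - g z) \<longlongrightarrow> - g 0) (at 0)"
    by (auto intro: tendsto_minus elim: Lim_transform_eventually)
  hence "g 0 = - g 0" using tendsto_unique[OF at_neq_bot] by blast
  hence g0: "g 0 = 0" by simp
  have "(g has_field_derivative deriv g 0) (at 0)"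
    using holomorphic_derivI[OF g S] by simp
  hence "((\<lambda>z. g z / z) \<longlongrightarrow> deriv g 0) (at 0)"
    by (simp add: has_field_derivative_iff g0)
  moreover have "eventually (\<lambda>z. g z / z = wp_reg z \<tau> / z ^ 2) (at 0)"
    using eventually_neq_at_within[of 0]
    by eventually_elim (simp add: g_def power2_eq_square)
  ultimately show ?thesis by (auto intro: Lim_transform_eventually)
qed

text \<open>The fourth-order poles of the second derivative and of
  \<open>6 * wp z \<tau> ^ 2\<close> cancel at \<open>0\<close>, and by periodicity at every period.
  The difference is constant by Liouville's theorem; its value stays unspecified.\<close>

lemma wp_ode:
  assumes \<tau>: "Im \<tau> > 0"
  obtains c where "\<And>z. z \<notin> period_lattice \<tau> \<Longrightarrow>
                     deriv (\<lambda>w. wp_z_series w \<tau>) z = 6 * wp z \<tau> ^ 2 + c"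
proof -
  let ?W = "\<lambda>w. wp_z_series w \<tau>" and ?h = "\<lambda>w. wp_reg w \<tau>"
  define E where "E = (\<lambda>z. deriv ?W z - 6 * wp z \<tau> ^ 2)"
  have notin: "eventually (\<lambda>w. w \<notin> period_lattice \<tau>) (at z)" for z
    by (rule eventually_notin_period_lattice[OF \<tau>])
  have per: "E (z + \<omega>) = E z" if "z \<notin> period_lattice \<tau>" "\<omega> \<in> period_lattice \<tau>" for z \<omega>
  proof -
    have "((\<lambda>w. wp_z_series (w + \<omega>) \<tau>) has_field_derivative deriv ?W (z + \<omega>)) (at z)"
      using wp_z_series_has_field_derivative[OF \<tau>, of "z + \<omega>"] that by (simp add: DERIV_shift)
    hence "deriv ?W z = deriv ?W (z + \<omega>)"
      by (simp add: wp_z_series_period that DERIV_imp_deriv)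
    thus ?thesis using wp_period[OF \<tau> that(2,1)] by (simp add: E_def)
  qed
  have "E holomorphic_on - period_lattice \<tau>"
    unfolding E_def
    by (intro holomorphic_intros holomorphic_deriv wp_z_series_holomorphic wp_holomorphic
              open_compl_period_lattice \<tau>)
  hence cont: "(E \<longlongrightarrow> E z) (at z)" if "z \<notin> period_lattice \<tau>" for z
    using that open_compl_period_lattice[OF \<tau>]
    by (meson ComplI continuous_on_eq_continuous_at holomorphic_on_imp_continuous_on isContD)
  have lim0: "\<exists>l. (E \<longlongrightarrow> l) (at 0)"
  proof -
    obtain l where l: "((\<lambda>z. ?h z / z ^ 2) \<longlongrightarrow> l) (at 0)"
      using wp_reg_div_square_tendsto[OF \<tau>] by blast
    \<comment> \<open>After the cancellation, the cross term of the square is the only one with a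
      denominator; its limit exists because \<open>?h\<close> vanishes to second order.\<close>
    have "((\<lambda>z. deriv (deriv ?h) z - 12 * (?h z / z ^ 2) - 6 * ?h z ^ 2) \<longlongrightarrow>
            deriv (deriv ?h) 0 - 12 * l - 6 * ?h 0 ^ 2) (at 0)"
      using wp_reg_isCont_0[OF \<tau>] l by (intro tendsto_intros) (simp_all add: isCont_def)
    moreover have "eventually (\<lambda>z. deriv (deriv ?h) z - 12 * (?h z / z ^ 2) - 6 * ?h z ^ 2 = E z) (at 0)"
      using notin eventually_neq_at_within[of 0]
    proof eventually_elim
      case (elim z)
      have "deriv ?h holomorphic_on - period_lattice \<tau>"
        by (intro holomorphic_deriv holomorphic_on_subset[OF wp_reg_holomorphic[OF \<tau>]]
                  open_compl_period_lattice \<tau>) auto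
      hence "(deriv ?h has_field_derivative deriv (deriv ?h) z) (at z)"
        using elim open_compl_period_lattice[OF \<tau>] by (auto intro: holomorphic_derivI)
      hence *: "((\<lambda>z. - 2 / z ^ 3 + deriv ?h z) has_field_derivative
                   (6 / z ^ 4 + deriv (deriv ?h) z)) (at z)"
        using elim by (auto intro!: derivative_eq_intros simp: field_simps eval_nat_numeral)
      have "(?W has_field_derivative (6 / z ^ 4 + deriv (deriv ?h) z)) (at z)"
        by (rule has_field_derivative_transform_within_open[OF * open_compl_period_lattice[OF \<tau>]])
           (use elim in \<open>auto simp: wp_z_series_eq_reg[OF \<tau>]\<close>)
      hence "deriv ?W z = 6 / z ^ 4 + deriv (deriv ?h) z" by (rule DERIV_imp_deriv)
      thus ?case using elim
        by (simp add: E_def wp_eq field_simps power2_eq_square eval_nat_numeral)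
    qed
    ultimately show ?thesis by (blast intro: Lim_transform_eventually)
  qed
  have "\<exists>l. (E \<longlongrightarrow> l) (at z)" for z
  proof (cases "z \<in> period_lattice \<tau>")
    case True
    obtain l where "(E \<longlongrightarrow> l) (at 0)" using lim0 by blast
    hence "((\<lambda>w. E (w + (-z))) \<longlongrightarrow> l) (at z)" using LIM_offset[of E l 0 "-z"] by simp
    moreover have "eventually (\<lambda>w. E (w + (-z)) = E w) (at z)"
      using notin by eventually_elim (use per True in blast)
    ultimately show ?thesis by (blast intro: Lim_transform_eventually)
  qed (use cont in blast)
  moreover have "E meromorphic_on UNIV"
    unfolding E_def
    by (intro meromorphic_intros wp_meromorphic wp_z_series_meromorphic \<tau>)
  moreover have "eventually (\<lambda>w. E (w + \<omega>) = E w) (at z)" if "\<omega> \<in> period_lattice \<tau>" for z \<omega>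
    using notin by eventually_elim (use per that in blast)
  ultimately obtain c where "\<And>z. (E \<longlongrightarrow> c) (at z)"
    using elliptic_liouville[OF \<tau>, of E] by blast
  hence "E z = c" if "z \<notin> period_lattice \<tau>" for z
    using cont[OF that] tendsto_unique[OF at_neq_bot] by blast
  thus ?thesis using that[of c] by (simp add: E_def algebra_simps)
qed

section \<open>Zeros of the derivative\<close>

text \<open>By Leibniz's rule the equation expresses each higher derivative of \<open>d\<close> at
  \<open>a\<close> through lower ones. All of them vanish by induction, and the identity theorem
  applies.\<close>

lemma second_order_linear_ode_zero:
  fixes d q :: "complex \<Rightarrow> complex"
  assumes S: "open S" "connected S" and d: "d holomorphic_on S" and q: "q holomorphic_on S"
    and ode: "\<And>w. w \<in> S \<Longrightarrow> deriv (deriv d) w = q w * d w"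
    and a: "a \<in> S" "d a = 0" "deriv d a = 0" and z: "z \<in> S"
  shows   "d z = 0"
proof -
  have "(deriv ^^ n) d a = 0" for n
  proof (induction n rule: less_induct)
    case (less n)
    consider "n = 0" | "n = 1" | k where "n = k + 2"
      by (metis One_nat_def Suc_1 add.commute less_2_cases linorder_not_less le_iff_add)
    thus ?case
    proof cases
      case (3 k)
      have "(deriv ^^ n) d a = (deriv ^^ k) (deriv (deriv d)) a"
        unfolding 3 by (simp add: funpow_Suc_right numeral_2_eq_2 del: funpow.simps)
      also have "\<dots> = (deriv ^^ k) (\<lambda>w. q w * d w) a"
        by (rule higher_deriv_transform_within_open[of _ S])
           (use ode S a d q in \<open>auto intro!: holomorphic_intros holomorphic_deriv\<close>)
      also have "\<dots> = (\<Sum>i=0..k. of_nat (k choose i) * (deriv ^^ i) q a * (deriv ^^ (k - i)) d a)"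
        using higher_deriv_mult[OF q d S(1) a(1)] .
      also have "\<dots> = 0"
        by (intro sum.neutral ballI) (use less.IH 3 in auto)
      finally show ?thesis .
    qed (use a in auto)
  qed
  from holomorphic_fun_eq_0_on_connected[OF d S this a(1) z] show ?thesis .
qed

text \<open>
  By uniqueness of the initial value problem for \<open>y'' = 6 y\<^sup>2 + c\<close>, a solution that is regular at
  \<open>0\<close> never touches \<open>\<wp>\<close>.
\<close>

lemma wp_transversal:
  assumes \<tau>: "Im \<tau> > 0"
    and c: "\<And>z. z \<notin> period_lattice \<tau> \<Longrightarrow> deriv (\<lambda>w. wp_z_series w \<tau>) z = 6 * wp z \<tau> ^ 2 + c"
    and A: "closed A" "countable A" and v: "v holomorphic_on - A"
    and ode: "\<And>z. z \<notin> A \<Longrightarrow> deriv (deriv v) z = 6 * v z ^ 2 + c"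
    and "0 \<notin> A" and a: "a \<notin> A" "a \<notin> period_lattice \<tau>" "v a = wp a \<tau>"
  shows   "deriv v a \<noteq> wp_z_series a \<tau>"
proof
  assume va: "deriv v a = wp_z_series a \<tau>"
  let ?W = "\<lambda>w. wp_z_series w \<tau>"
  define S where "S = - (period_lattice \<tau> \<union> A)"
  have "closed (period_lattice \<tau> \<union> A)" "countable (period_lattice \<tau> \<union> A)"
    using A closed_subset_period_lattice[OF \<tau> order.refl] by (auto simp: countable_period_lattice)
  hence S: "open S" "connected S"
    unfolding S_def by (auto simp only: open_Compl intro: connected_compl_countable)
  have memS: "w \<notin> period_lattice \<tau>" "w \<notin> A" if "w \<in> S" for w
    using that by (auto simp: S_def)
  define d where "d = (\<lambda>w. wp w \<tau> - v w)"
  have v': "(v has_field_derivative deriv v w) (at w)"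
    and v'': "(deriv v has_field_derivative deriv (deriv v) w) (at w)" if "w \<in> S" for w
    using that memS(2)[OF that] v A(1) by (auto intro!: holomorphic_derivI[of _ "-A"] holomorphic_deriv)
  have d': "deriv d w = ?W w - deriv v w" if "w \<in> S" for w
    unfolding d_def
    by (intro DERIV_imp_deriv DERIV_diff wp_has_field_derivative \<tau> memS v' that)
  \<comment> \<open>Subtracting the two equations cancels \<open>c\<close>, and the difference of
    squares factors, so \<open>d\<close> solves a linear equation.\<close>
  have d'': "deriv (deriv d) w = 6 * (wp w \<tau> + v w) * d w" if w: "w \<in> S" for w
  proof -
    have "((\<lambda>w. ?W w - deriv v w) has_field_derivative
             (6 * wp w \<tau> ^ 2 + c) - (6 * v w ^ 2 + c)) (at w)"
      using wp_z_series_has_field_derivative[OF \<tau> memS(1)[OF w]] v''[OF w]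
      by (intro DERIV_diff) (simp_all add: c ode memS[OF w])
    hence "(deriv d has_field_derivative (6 * wp w \<tau> ^ 2 + c) - (6 * v w ^ 2 + c)) (at w)"
      by (rule has_field_derivative_transform_within_open[OF _ S(1) w]) (simp add: d')
    hence "deriv (deriv d) w = (6 * wp w \<tau> ^ 2 + c) - (6 * v w ^ 2 + c)"
      by (rule DERIV_imp_deriv)
    thus ?thesis by (simp add: d_def power2_eq_square algebra_simps)
  qed
  have holo: "(\<lambda>w. wp w \<tau>) holomorphic_on S" "v holomorphic_on S"
    using wp_holomorphic[OF \<tau>] v by (auto elim!: holomorphic_on_subset simp: S_def)
  have zero: "wp w \<tau> = v w" if "w \<in> S" for w
  proof -
    have "a \<in> S" using a by (simp add: S_def)
    have "d w = 0"
      by (rule second_order_linear_ode_zero[OF S, of d "\<lambda>w. 6 * (wp w \<tau> + v w)" a])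
         (use holo d'' d' that \<open>a \<in> S\<close> a va in \<open>auto simp: d_def intro!: holomorphic_intros\<close>)
    thus ?thesis by (simp add: d_def)
  qed
  \<comment> \<open>Agreement on \<open>S\<close> makes \<open>w ^ 2 * wp w \<tau>\<close> tend to
    \<open>0\<close> at the origin, against the limit \<open>1\<close> coming from the double
    pole.\<close>
  have "(v \<longlongrightarrow> v 0) (at 0)"
    using v A(1) \<open>0 \<notin> A\<close>
    by (meson ComplI open_Compl continuous_on_eq_continuous_at holomorphic_on_imp_continuous_on isContD)
  hence "((\<lambda>w. w ^ 2 * v w) \<longlongrightarrow> 0 ^ 2 * v 0) (at 0)"
    by (intro tendsto_intros)
  moreover have "eventually (\<lambda>w. w ^ 2 * v w = w ^ 2 * wp w \<tau>) (at 0)"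
  proof -
    have "eventually (\<lambda>w. w \<in> - A) (at 0)"
      using A(1) \<open>0 \<notin> A\<close> by (intro eventually_at_in_open') auto
    thus ?thesis using eventually_notin_period_lattice[OF \<tau>, of 0]
      by eventually_elim (simp add: zero S_def)
  qed
  ultimately have "((\<lambda>w. w ^ 2 * wp w \<tau>) \<longlongrightarrow> 0) (at 0)"
    by (auto intro: Lim_transform_eventually)
  with wp_pole_tendsto[OF \<tau>] show False
    using tendsto_unique[OF at_neq_bot] zero_neq_one by metis
qed

text \<open>Otherwise the constant \<open>wp a \<tau>\<close> would be a second solution with the
  same data at \<open>a\<close>. Simple zeros in the denominator are what the later quotient
  argument relies on.\<close>

lemma wp_z_series_zero_simple:
  assumes \<tau>: "Im \<tau> > 0" and a: "a \<notin> period_lattice \<tau>" "wp_z_series a \<tau> = 0"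
  shows   "deriv (\<lambda>w. wp_z_series w \<tau>) a \<noteq> 0"
proof
  assume *: "deriv (\<lambda>w. wp_z_series w \<tau>) a = 0"
  obtain c where c: "\<And>z. z \<notin> period_lattice \<tau> \<Longrightarrow>
      deriv (\<lambda>w. wp_z_series w \<tau>) z = 6 * wp z \<tau> ^ 2 + c"
    using wp_ode[OF \<tau>] by blast
  have "deriv (\<lambda>_. wp a \<tau>) a \<noteq> wp_z_series a \<tau>"
    by (rule wp_transversal[OF \<tau> c, of "{}"]) (use c[of a] * a in auto)
  thus False using a by simp
qed

text \<open>Reflection about \<open>a\<close> preserves the equation, and a vanishing derivative
  makes the data at \<open>a\<close> agree. If \<open>2 * a\<close> were not a period, the reflected
  function would be regular at \<open>0\<close>, contradicting
  \<open>wp_transversal\<close>.\<close>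

lemma wp_z_series_zero_imp:
  assumes \<tau>: "Im \<tau> > 0" and a: "a \<notin> period_lattice \<tau>" "wp_z_series a \<tau> = 0"
  shows   "2 * a \<in> period_lattice \<tau>"
proof (rule ccontr)
  assume *: "2 * a \<notin> period_lattice \<tau>"
  let ?W = "\<lambda>w. wp_z_series w \<tau>"
  obtain c where c: "\<And>z. z \<notin> period_lattice \<tau> \<Longrightarrow> deriv ?W z = 6 * wp z \<tau> ^ 2 + c"
    using wp_ode[OF \<tau>] by blast
  define v where "v = (\<lambda>w. wp (2 * a - w) \<tau>)"
  define A where "A = (\<lambda>w. 2 * a - w) -` period_lattice \<tau>"
  have A: "closed A"
    unfolding A_def
    by (intro continuous_closed_vimage closed_subset_period_lattice[OF \<tau>])
       (auto intro!: continuous_intros)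
  have "A = (\<lambda>w. 2 * a - w) ` period_lattice \<tau>"
    by (force simp: A_def image_iff)
  hence cA: "countable A" by (simp add: countable_period_lattice)
  have v: "(v has_field_derivative - ?W (2 * a - w)) (at w)" if "w \<notin> A" for w
  proof -
    have "((\<lambda>w. 2 * a - w) has_field_derivative - 1) (at w)"
      by (auto intro!: derivative_eq_intros)
    moreover have "2 * a - w \<notin> period_lattice \<tau>" using that by (simp add: A_def)
    ultimately have "(v has_field_derivative ?W (2 * a - w) * - 1) (at w)"
      unfolding v_def by (intro DERIV_chain2[OF wp_has_field_derivative[OF \<tau>]])
    thus ?thesis by simp
  qed
  have v': "deriv (deriv v) w = 6 * v w ^ 2 + c" if w: "w \<notin> A" for w
  proof -
    have "((\<lambda>w. - ?W (2 * a - w)) has_field_derivative deriv ?W (2 * a - w)) (at w)"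
    proof -
      have "((\<lambda>w. 2 * a - w) has_field_derivative - 1) (at w)"
        by (auto intro!: derivative_eq_intros)
      moreover have "2 * a - w \<notin> period_lattice \<tau>" using w by (simp add: A_def)
      ultimately have "((\<lambda>w. ?W (2 * a - w)) has_field_derivative deriv ?W (2 * a - w) * - 1) (at w)"
        by (intro DERIV_chain2[OF wp_z_series_has_field_derivative[OF \<tau>]])
      from DERIV_minus[OF this] show ?thesis by simp
    qed
    hence "(deriv v has_field_derivative deriv ?W (2 * a - w)) (at w)"
      by (rule has_field_derivative_transform_within_open[of _ _ _ "- A"])
         (use w A in \<open>auto intro!: DERIV_imp_deriv[symmetric] v\<close>)
    thus ?thesis using w by (simp add: DERIV_imp_deriv c A_def v_def)
  qed
  have "deriv v a \<noteq> ?W a"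
  proof (rule wp_transversal[OF \<tau> c A cA _ v'])
    show "v holomorphic_on - A"
    proof (rule holomorphic_onI)
      fix w assume "w \<in> - A"
      thus "v field_differentiable at w within - A"
        using v by (meson ComplD field_differentiable_at_within field_differentiable_def)
    qed
  qed (use * a in \<open>auto simp: A_def v_def\<close>)
  moreover have "deriv v a = 0"
    using DERIV_imp_deriv[OF v[of a]] a by (simp add: A_def)
  ultimately show False using a by simp
qed

text \<open>Oddness and periodicity make the value equal to its own negative. Periods
  \<open>a\<close> themselves are included.\<close>

lemma wp_z_series_half_period:
  assumes "2 * a \<in> period_lattice \<tau>"
  shows   "wp_z_series a \<tau> = 0"
proof -
  have "wp_z_series a \<tau> = wp_z_series (- a + 2 * a) \<tau>" by simp
  also have "\<dots> = - wp_z_series a \<tau>"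
    using assms by (simp only: wp_z_series_period wp_z_series_minus)
  finally show ?thesis by simp
qed

section \<open>Product formulas\<close>

lemma wp_z_series_isCont:
  "Im \<tau> > 0 \<Longrightarrow> z \<notin> period_lattice \<tau> \<Longrightarrow> isCont (\<lambda>w. wp_z_series w \<tau>) z"
  using wp_z_series_has_field_derivative DERIV_isCont by blast

text \<open>
  The index \<open>i\<^sub>0\<close> belongs to the trivial coset. The coset representatives \<open>t i\<close> make up
  \<open>\<Lambda>\<^sub>\<sigma> / n\<close> modulo \<open>\<Lambda>\<^sub>\<tau>\<close>, and the factor \<open>2\<close> in the injectivity
  assumption expresses that the index is odd, so that the half periods of the two lattices match.
\<close>

lemma wp_z_series_scale_eq_prod:
  fixes t :: "'i \<Rightarrow> complex" and n :: nat
  assumes \<tau>: "Im \<tau> > 0" and \<sigma>: "Im \<sigma> > 0" and n: "n > 0"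
    and I: "finite I" "i\<^sub>0 \<in> I" "t i\<^sub>0 = 0"
    and cosets: "\<And>z. of_nat n * z \<in> period_lattice \<sigma> \<longleftrightarrow> (\<exists>i\<in>I. z + t i \<in> period_lattice \<tau>)"
    and inj: "\<forall>i\<in>I. \<forall>j\<in>I. 2 * (t i - t j) \<in> period_lattice \<tau> \<longrightarrow> i = j"
  defines "P \<equiv> \<Prod>i\<in>I-{i\<^sub>0}. wp_z_series (t i) \<tau>"
  shows "P \<noteq> 0"
    and "\<And>z. of_nat n * z \<notin> period_lattice \<sigma> \<Longrightarrow>
           wp_z_series (of_nat n * z) \<sigma> = 1 / (of_nat n ^ 3 * P) * (\<Prod>i\<in>I. wp_z_series (z + t i) \<tau>)"
proof -
  define L where "L = period_lattice \<tau>"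
  define f where "f = (\<lambda>w. wp_z_series w \<tau>)"
  define g where "g = (\<lambda>w. wp_z_series (of_nat n * w) \<sigma>)"
  \<comment> \<open>\<open>F\<close> is the right-hand side without its constant, \<open>G i\<close>
    is \<open>F\<close> without the factor \<open>i\<close>, and the aim is that the quotient
    \<open>R\<close> has one and the same limit everywhere.\<close>
  define F where "F = (\<lambda>w. \<Prod>i\<in>I. f (w + t i))"
  define G where "G = (\<lambda>i w. \<Prod>j\<in>I-{i}. f (w + t j))"
  define R where "R = (\<lambda>w. g w / F w)"

  have f_cont: "isCont f z" if "z \<notin> L" for z
    using wp_z_series_isCont[OF \<tau>] that by (simp add: f_def L_def)
  have f_nz: "f z \<noteq> 0" if "z \<notin> L" "2 * z \<notin> L" for z
    using wp_z_series_zero_imp[OF \<tau>] that by (auto simp: f_def L_def)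
  have f_shift_cont: "isCont (\<lambda>w. f (w + t i)) z" if "z + t i \<notin> L" for z i
    by (rule isCont_o2[where f = "\<lambda>w. w + t i" and g = f]) (use that f_cont in auto)
  have g_cont: "isCont g z" if "of_nat n * z \<notin> period_lattice \<sigma>" for z
    unfolding g_def
    by (rule isCont_o2[where f = "\<lambda>w. of_nat n * w" and g = "\<lambda>w. wp_z_series w \<sigma>"])
       (use that wp_z_series_isCont[OF \<sigma>] in auto)
  \<comment> \<open>At most one factor has a zero or a pole at a given point: two such indices would
    make the doubled difference of their shifts a period, against \<open>inj\<close>.\<close>
  have other: "z + t j \<notin> L" "2 * (z + t j) \<notin> L"
    if "i \<in> I" "2 * (z + t i) \<in> L" "j \<in> I - {i}" for z i j
  proof -
    show *: "2 * (z + t j) \<notin> L"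
    proof
      assume "2 * (z + t j) \<in> L"
      hence "2 * (z + t j) - 2 * (z + t i) \<in> L" using that(2) unfolding L_def by blast
      also have "2 * (z + t j) - 2 * (z + t i) = 2 * (t j - t i)" by (simp add: algebra_simps)
      finally show False using inj that by (auto simp: L_def)
    qed
    show "z + t j \<notin> L"
      using * period_lattice_of_nat_mult[of "z + t j" \<tau> 2] by (auto simp: L_def)
  qed
  have double: "2 * z \<in> L" if "z \<in> L" for z
    using period_lattice_of_nat_mult[of z \<tau> 2] that by (simp add: L_def)
  have F_split: "F w = f (w + t i) * G i w" if "i \<in> I" for i w
    unfolding F_def G_def using I(1) that by (simp add: prod.remove)
  have G_nz: "G i z \<noteq> 0" if "i \<in> I" "2 * (z + t i) \<in> L" for i z
    unfolding G_def using other[OF that] f_nz I(1) by (auto simp: prod_zero_iff)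
  have G_lim: "(G i \<longlongrightarrow> G i z) (at z)" if "i \<in> I" "2 * (z + t i) \<in> L" for i z
    unfolding G_def using other(1)[OF that] f_shift_cont
    by (intro tendsto_prod) (auto simp: isCont_def)
  \<comment> \<open>Scaling by \<open>n\<close> sends half periods for \<open>\<tau>\<close> to half
    periods for \<open>\<sigma>\<close>; the shift is harmless because
    \<open>of_nat n * (- t i)\<close> is a period for \<open>\<sigma>\<close>.\<close>
  have half: "g z = 0" if "i \<in> I" "2 * (z + t i) \<in> L" for i z
  proof -
    have "of_nat n * (2 * (z + t i)) \<in> period_lattice \<sigma>"
      unfolding cosets using that I by (auto simp: L_def intro!: bexI[of _ i\<^sub>0])
    moreover have "of_nat n * (- t i) \<in> period_lattice \<sigma>"
      unfolding cosets using that I by (intro bexI[of _ i]) auto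
    hence "of_nat 2 * (of_nat n * (- t i)) \<in> period_lattice \<sigma>"
      by (rule period_lattice_of_nat_mult)
    ultimately have "of_nat n * (2 * (z + t i)) + of_nat 2 * (of_nat n * (- t i)) \<in> period_lattice \<sigma>"
      by (rule period_lattice_add)
    also have "of_nat n * (2 * (z + t i)) + of_nat 2 * (of_nat n * (- t i)) = 2 * (of_nat n * z)"
      by (simp add: algebra_simps)
    finally show ?thesis unfolding g_def by (rule wp_z_series_half_period)
  qed

  \<comment> \<open>Numerator and factor \<open>i\<close> both have a triple pole here; the scaled
    argument in \<open>g\<close> produces the factor \<open>n ^ 3\<close>.\<close>
  have pole: "(R \<longlongrightarrow> 1 / (of_nat n ^ 3 * G i z)) (at z)" if i: "i \<in> I" "z + t i \<in> L" for i z
  proof -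
    have 2: "2 * (z + t i) \<in> L" using double i by blast
    have lim0: "filterlim (\<lambda>w. c * (w - z)) (at 0) (at z)" if "c \<noteq> 0" for c :: complex
      using that by (auto simp: filterlim_at eventually_at_filter intro!: tendsto_eq_intros)
    have "((\<lambda>w. (1 * (w - z)) ^ 3 * f (1 * (w - z))) \<longlongrightarrow> - 2) (at z)"
      unfolding f_def by (rule filterlim_compose[OF wp_z_series_pole_tendsto[OF \<tau>] lim0]) simp
    moreover have "f (w - z) = f (w + t i)" for w
      using wp_z_series_period[of "z + t i" \<tau> "w - z"] i(2)
      by (simp add: f_def L_def algebra_simps)
    ultimately have f_lim: "((\<lambda>w. (w - z) ^ 3 * f (w + t i)) \<longlongrightarrow> - 2) (at z)" by simp
    have nz: "of_nat n * z \<in> period_lattice \<sigma>"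
      unfolding cosets using i by (auto simp: L_def)
    have "((\<lambda>w. (of_nat n * (w - z)) ^ 3 * wp_z_series (of_nat n * (w - z)) \<sigma>) \<longlongrightarrow> - 2) (at z)"
      by (rule filterlim_compose[OF wp_z_series_pole_tendsto[OF \<sigma>] lim0]) (use n in simp)
    moreover have "wp_z_series (of_nat n * (w - z)) \<sigma> = g w" for w
      using wp_z_series_period[OF nz, of "of_nat n * (w - z)"] by (simp add: g_def algebra_simps)
    ultimately have "((\<lambda>w. (of_nat n * (w - z)) ^ 3 * g w / of_nat n ^ 3) \<longlongrightarrow> - 2 / of_nat n ^ 3) (at z)"
      using n by (intro tendsto_intros) auto
    hence g_lim: "((\<lambda>w. (w - z) ^ 3 * g w) \<longlongrightarrow> - 2 / of_nat n ^ 3) (at z)"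
      using n by (simp add: power_mult_distrib)
    have "((\<lambda>w. ((w - z) ^ 3 * g w) / ((w - z) ^ 3 * f (w + t i) * G i w)) \<longlongrightarrow>
            (- 2 / of_nat n ^ 3) / (- 2 * G i z)) (at z)"
      using G_nz[OF i(1) 2] by (intro tendsto_intros g_lim f_lim G_lim i 2) auto
    moreover have "eventually (\<lambda>w. ((w - z) ^ 3 * g w) / ((w - z) ^ 3 * f (w + t i) * G i w) = R w) (at z)"
      using eventually_neq_at_within[of z]
      by eventually_elim (simp add: R_def F_split[OF i(1)])
    ultimately have "(R \<longlongrightarrow> (- 2 / of_nat n ^ 3) / (- 2 * G i z)) (at z)"
      by (rule Lim_transform_eventually)
    thus ?thesis using n by simp
  qed

  \<comment> \<open>Here \<open>g\<close> vanishes and factor \<open>i\<close> has a simple zero, so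
    both are divided by \<open>w - z\<close> before passing to the limit.\<close>
  have zero: "\<exists>l. (R \<longlongrightarrow> l) (at z)" if i: "i \<in> I" "2 * (z + t i) \<in> L" "z + t i \<notin> L" for i z
  proof -
    have "of_nat n * z \<notin> period_lattice \<sigma>"
      unfolding cosets using i other(1)[OF i(1,2)] by (auto simp: L_def)
    hence "((\<lambda>w. wp_z_series w \<sigma>) has_field_derivative
             deriv (\<lambda>w. wp_z_series w \<sigma>) (of_nat n * z)) (at (of_nat n * z))"
      by (rule wp_z_series_has_field_derivative[OF \<sigma>])
    moreover have "((\<lambda>w. of_nat n * w) has_field_derivative of_nat n) (at z)"
      by (auto intro!: derivative_eq_intros)
    ultimately obtain D where "(g has_field_derivative D) (at z)"
      unfolding g_def using DERIV_chain2 by blast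
    hence g_lim: "((\<lambda>w. g w / (w - z)) \<longlongrightarrow> D) (at z)"
      using half[OF i(1,2)] by (simp add: has_field_derivative_iff)
    define E where "E = deriv f (z + t i)"
    have f0: "f (z + t i) = 0"
      unfolding f_def using i by (intro wp_z_series_half_period) (simp add: L_def)
    have "(f has_field_derivative E) (at (z + t i))"
      using wp_z_series_has_field_derivative[OF \<tau>, of "z + t i"] i(3)
      by (simp add: f_def E_def L_def)
    hence "((\<lambda>w. f (w + t i)) has_field_derivative E) (at z)" by (simp add: DERIV_shift)
    hence f_lim: "((\<lambda>w. f (w + t i) / (w - z)) \<longlongrightarrow> E) (at z)"
      using f0 by (simp add: has_field_derivative_iff)
    have "E \<noteq> 0"
      using wp_z_series_zero_simple[OF \<tau>, of "z + t i"] i(3) f0 by (simp add: E_def f_def L_def)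
    hence "((\<lambda>w. (g w / (w - z)) / (f (w + t i) / (w - z) * G i w)) \<longlongrightarrow> D / (E * G i z)) (at z)"
      using G_nz[OF i(1,2)] by (intro tendsto_intros g_lim f_lim G_lim i) auto
    moreover have "eventually (\<lambda>w. (g w / (w - z)) / (f (w + t i) / (w - z) * G i w) = R w) (at z)"
      using eventually_neq_at_within[of z]
      by eventually_elim (simp add: R_def F_split[OF i(1)])
    ultimately show ?thesis by (blast intro: Lim_transform_eventually)
  qed

  have R_cont: "(R \<longlongrightarrow> R z) (at z)"
    if "of_nat n * z \<notin> period_lattice \<sigma>" "F z \<noteq> 0" for z
  proof -
    have "isCont F z"
      unfolding F_def using that(1) f_shift_cont unfolding cosets
      by (intro continuous_intros) (auto simp: L_def)
    thus ?thesis
      using g_cont[OF that(1)] that(2) unfolding R_def isCont_def by (intro tendsto_intros)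
  qed

  \<comment> \<open>If some \<open>2 * (z + t i)\<close> is a period, the pole case or the zero case
    applies; otherwise \<open>R\<close> is continuous at \<open>z\<close>.\<close>
  have "\<exists>l. (R \<longlongrightarrow> l) (at z)" for z
  proof (cases "\<exists>i\<in>I. 2 * (z + t i) \<in> L")
    case True
    thus ?thesis using pole zero by metis
  next
    case False
    moreover from this have "\<forall>i\<in>I. z + t i \<notin> L" using double by blast
    ultimately have "F z \<noteq> 0" "of_nat n * z \<notin> period_lattice \<sigma>"
      using f_nz I(1) by (auto simp: F_def cosets L_def[symmetric])
    thus ?thesis using R_cont by blast
  qed
  moreover have "R meromorphic_on UNIV"
  proof -
    have "(\<lambda>w. wp_z_series (w + t i) \<tau>) meromorphic_on UNIV" for i
      by (rule meromorphic_on_compose[OF wp_z_series_meromorphic[OF \<tau>]]) (auto intro!: analytic_intros)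
    moreover have "(\<lambda>w. wp_z_series (of_nat n * w) \<sigma>) meromorphic_on UNIV"
      by (rule meromorphic_on_compose[OF wp_z_series_meromorphic[OF \<sigma>]]) (auto intro!: analytic_intros)
    ultimately show ?thesis
      unfolding R_def F_def f_def g_def by (intro meromorphic_on_divide meromorphic_on_prod)
  qed
  moreover have "eventually (\<lambda>w. R (w + \<omega>) = R w) (at z)" if "\<omega> \<in> period_lattice \<tau>" for z \<omega>
  proof (intro always_eventually allI)
    fix w
    \<comment> \<open>By the trivial coset, \<open>n\<close> times a period for
      \<open>\<tau>\<close> is a period for \<open>\<sigma>\<close>.\<close>
    have "of_nat n * \<omega> \<in> period_lattice \<sigma>"
      unfolding cosets using that I by (intro bexI[of _ i\<^sub>0]) auto
    from wp_z_series_period[OF this, of "of_nat n * w"] have "g (w + \<omega>) = g w"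
      by (simp add: g_def algebra_simps)
    moreover have "f (w + \<omega> + t i) = f (w + t i)" for i
      using wp_z_series_period[OF that, of "w + t i"] by (simp add: f_def add_ac)
    ultimately show "R (w + \<omega>) = R w" by (simp add: R_def F_def)
  qed
  ultimately obtain c where c: "\<And>z. (R \<longlongrightarrow> c) (at z)"
    using elliptic_liouville[OF \<tau>, of R] by blast
  have GP: "G i\<^sub>0 0 = P"
    by (simp add: G_def P_def f_def)
  show "P \<noteq> 0"
    using G_nz[of i\<^sub>0 0] I by (simp add: GP L_def)
  have "(R \<longlongrightarrow> 1 / (of_nat n ^ 3 * P)) (at 0)"
    using pole[of i\<^sub>0 0] I by (simp add: GP L_def)
  hence c_eq: "c = 1 / (of_nat n ^ 3 * P)"
    using c[of 0] tendsto_unique[OF at_neq_bot] by blast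
  fix z assume z: "of_nat n * z \<notin> period_lattice \<sigma>"
  \<comment> \<open>At a zero of \<open>F\<close> the value \<open>R z\<close> is a division by
    zero, so there the vanishing of \<open>g\<close> is used directly.\<close>
  have "g z = c * F z"
  proof (cases "F z = 0")
    case True
    then obtain i where i: "i \<in> I" "f (z + t i) = 0"
      using I(1) by (auto simp: F_def)
    have "z + t i \<notin> L" using z i(1) unfolding cosets by (auto simp: L_def)
    hence "2 * (z + t i) \<in> L" using f_nz i(2) by blast
    with half i True show ?thesis by simp
  next
    case False
    have "R z = c" using R_cont[OF z False] c[of z] tendsto_unique[OF at_neq_bot] by blast
    with False show ?thesis by (simp add: R_def field_simps)
  qed
  thus "wp_z_series (of_nat n * z) \<sigma> = 1 / (of_nat n ^ 3 * P) * (\<Prod>i\<in>I. wp_z_series (z + t i) \<tau>)"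
    by (simp add: g_def F_def f_def c_eq)
qed

text \<open>The series and \<open>wp_z\<close> agree off the lattice. The points \<open>t i\<close>
  in \<open>P\<close> avoid it by \<open>inj\<close>, applied to \<open>i\<close> and
  \<open>i\<^sub>0\<close>; the points \<open>z + t i\<close> avoid it by
  \<open>cosets\<close>.\<close>

lemma wp_z_scale_eq_prod:
  fixes t :: "'i \<Rightarrow> complex" and n :: nat
  assumes \<tau>: "Im \<tau> > 0" and \<sigma>: "Im \<sigma> > 0" and n: "n > 0"
    and I: "finite I" "i\<^sub>0 \<in> I" "t i\<^sub>0 = 0"
    and cosets: "\<And>z. of_nat n * z \<in> period_lattice \<sigma> \<longleftrightarrow> (\<exists>i\<in>I. z + t i \<in> period_lattice \<tau>)"
    and inj: "\<forall>i\<in>I. \<forall>j\<in>I. 2 * (t i - t j) \<in> period_lattice \<tau> \<longrightarrow> i = j"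
  defines "P \<equiv> \<Prod>i\<in>I-{i\<^sub>0}. wp_z (t i) \<tau>"
  shows "P \<noteq> 0"
    and "\<And>z. of_nat n * z \<notin> period_lattice \<sigma> \<Longrightarrow>
           wp_z (of_nat n * z) \<sigma> = 1 / (of_nat n ^ 3 * P) * (\<Prod>i\<in>I. wp_z (z + t i) \<tau>)"
proof -
  have "t i \<notin> period_lattice \<tau>" if "i \<in> I - {i\<^sub>0}" for i
    using inj that I period_lattice_of_nat_mult[of "t i" \<tau> 2] by auto
  hence P: "P = (\<Prod>i\<in>I-{i\<^sub>0}. wp_z_series (t i) \<tau>)"
    unfolding P_def by (intro prod.cong refl wp_z_eq_series[OF \<tau>])
  note * = wp_z_series_scale_eq_prod[OF \<tau> \<sigma> n I cosets inj, folded P]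
  show "P \<noteq> 0" by (rule *(1))
  fix z assume z: "of_nat n * z \<notin> period_lattice \<sigma>"
  hence "(\<Prod>i\<in>I. wp_z (z + t i) \<tau>) = (\<Prod>i\<in>I. wp_z_series (z + t i) \<tau>)"
    unfolding cosets by (intro prod.cong refl wp_z_eq_series[OF \<tau>]) auto
  with *(2)[OF z] wp_z_eq_series[OF \<sigma> z]
  show "wp_z (of_nat n * z) \<sigma> = 1 / (of_nat n ^ 3 * P) * (\<Prod>i\<in>I. wp_z (z + t i) \<tau>)" by simp
qed

section \<open>Residues modulo \<open>n\<close> and the two multiplication formulas\<close>

lemma eq_if_odd_dvd_double_diff:
  fixes i j n :: nat
  assumes "odd n" "i < n" "j < n" "int n dvd 2 * (int i - int j)"
  shows   "i = j"
proof -
  have "coprime (int n) 2" using assms(1) by simp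
  hence "int n dvd int i - int j" using assms(4) coprime_dvd_mult_right_iff by blast
  moreover have "\<bar>int i - int j\<bar> < int n" using assms(2,3) by linarith
  ultimately show ?thesis using zdvd_not_zless zdvd_imp_le
    by (metis abs_ge_zero abs_of_nat dvd_abs_iff eq_iff_diff_eq_0 nat_int_comparison(1)
              not_less zero_less_abs_iff)
qed

lemma ex_nat_less_int_dvd_add:
  assumes "n > 0"
  shows   "\<exists>k<n. int n dvd m + int k"
proof (intro exI conjI)
  show "nat ((- m) mod int n) < n" using assms by (simp add: nat_less_iff)
  have "m + (- m) mod int n = - (int n * ((- m) div int n))"
    using mult_div_mod_eq[of "int n" "- m"] by linarith
  thus "int n dvd m + int (nat ((- m) mod int n))" using assms by simp
qed

text \<open>The point is \<open>1 / 2\<close>, a half period that is not itself a period.\<close>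

lemma wp_z_half:
  assumes "Im \<tau> > 0" "even n" "n > 0"
  shows   "wp_z (of_nat (n div 2) / of_nat n) \<tau> = 0"
proof -
  have eq: "of_nat (n div 2) / of_nat n = (1 / 2 :: complex)"
    using assms(2,3) by (auto elim!: evenE)
  have "1 / 2 \<notin> period_lattice \<tau>"
    using period_lattice_div_iff[OF assms(1), of 2 1 0] by simp
  thus ?thesis
    unfolding eq using wp_z_eq_series[OF assms(1)] wp_z_series_half_period[of "1 / 2" \<tau>] by simp
qed

theorem theorem4:
  fixes \<tau> :: complex and n :: nat
  assumes "Im \<tau> > 0" and "n \<ge> 2"
  shows "let P = (\<Prod>k=1..n-1. wp_z (of_nat k / of_nat n) \<tau>);
             Q = (\<Prod>(k, j)\<in>{(k, j). k \<le> n - 1 \<and> j \<le> n - 1 \<and> (k, j) \<noteq> (0, 0)}.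
                    wp_z (of_nat k / of_nat n + of_nat j * \<tau> / of_nat n) \<tau>)
         in (odd n \<longrightarrow> P \<noteq> 0 \<and> Q \<noteq> 0) \<and>
            (P \<noteq> 0 \<longrightarrow>
              (\<forall>z. of_nat n * z \<notin> period_lattice (of_nat n * \<tau>) \<longrightarrow>
                 wp_z (of_nat n * z) (of_nat n * \<tau>) =
                   1 / (of_nat n ^ 3 * P) * (\<Prod>k=0..n-1. wp_z (z + of_nat k / of_nat n) \<tau>))) \<and>
            (Q \<noteq> 0 \<longrightarrow>
              (\<exists>C. inverse C = of_nat n ^ 3 * Q \<and>
                (\<forall>z. of_nat n * z \<notin> period_lattice \<tau> \<longrightarrow>
                   wp_z (of_nat n * z) \<tau> =
                     C * (\<Prod>k=0..n-1. \<Prod>j=0..n-1.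
                            wp_z (z + of_nat k / of_nat n + of_nat j * \<tau> / of_nat n) \<tau>))))"
proof -
  define P where "P = (\<Prod>k=1..n-1. wp_z (of_nat k / of_nat n) \<tau>)"
  define Q where "Q = (\<Prod>(k, j)\<in>{(k, j). k \<le> n - 1 \<and> j \<le> n - 1 \<and> (k, j) \<noteq> (0, 0)}.
                         wp_z (of_nat k / of_nat n + of_nat j * \<tau> / of_nat n) \<tau>)"
  define J where "J = {0..n-1} \<times> {0..n-1}"
  have n: "n > 0" using assms(2) by simp
  note \<tau> = assms(1)
  have J: "{(k, j). k \<le> n - 1 \<and> j \<le> n - 1 \<and> (k, j) \<noteq> (0, 0)} = J - {(0, 0)}"
    by (auto simp: J_def)
  show ?thesis
  proof (cases "odd n")
    case False
    \<comment> \<open>Both products contain the factor at \<open>1 / 2\<close>, so every implication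
      in the claim has a false premise.\<close>
    have "P = 0"
      unfolding P_def using assms(2) False wp_z_half[OF \<tau>, of n] n
      by (intro prod_zero bexI[of _ "n div 2"]) auto
    moreover have "Q = 0"
      unfolding Q_def J using assms(2) False wp_z_half[OF \<tau>, of n] n
      by (intro prod_zero bexI[of _ "(n div 2, 0)"]) (auto simp: J_def)
    ultimately show ?thesis
      unfolding Let_def P_def[symmetric] Q_def[symmetric] using False by simp
  next
    case True
    have n\<tau>: "Im (of_nat n * \<tau>) > 0" using \<tau> n by simp
    \<comment> \<open>Dividing the target lattice by \<open>n\<close> gives the lattice generated by
      \<open>1 / n\<close> and \<open>\<tau>\<close>, whose classes modulo the periods for
      \<open>\<tau>\<close> are represented by the points \<open>k / n\<close>.\<close>
    have cosets1: "of_nat n * z \<in> period_lattice (of_nat n * \<tau>) \<longleftrightarrow>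
        (\<exists>k\<in>{0..n-1}. z + of_nat k / of_nat n \<in> period_lattice \<tau>)" for z
    proof
      assume "of_nat n * z \<in> period_lattice (of_nat n * \<tau>)"
      then obtain a b :: int where ab: "of_nat n * z = of_int a + of_int b * (of_nat n * \<tau>)"
        unfolding period_lattice_def by blast
      obtain k where k: "k < n" "int n dvd a + int k" using ex_nat_less_int_dvd_add[OF n] by blast
      have "z + of_nat k / of_nat n = (of_int (a + int k) + of_int (b * int n) * \<tau>) / of_nat n"
        using ab n by (simp add: field_simps)
      also have "\<dots> \<in> period_lattice \<tau>" unfolding period_lattice_div_iff[OF \<tau> n] using k by simp
      finally show "\<exists>k\<in>{0..n-1}. z + of_nat k / of_nat n \<in> period_lattice \<tau>"
        using k by (intro bexI[of _ k]) auto
    next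
      assume "\<exists>k\<in>{0..n-1}. z + of_nat k / of_nat n \<in> period_lattice \<tau>"
      then obtain k and a b :: int where "z + of_nat k / of_nat n = of_int a + of_int b * \<tau>"
        unfolding period_lattice_def by blast
      hence "of_nat n * z = of_int (int n * a - int k) + of_int b * (of_nat n * \<tau>)"
        using n by (simp add: field_simps)
      thus "of_nat n * z \<in> period_lattice (of_nat n * \<tau>)"
        unfolding period_lattice_def by blast
    qed
    \<comment> \<open>Clearing denominators leaves a divisibility by \<open>n\<close>, in which the
      factor \<open>2\<close> cancels because \<open>n\<close> is odd.\<close>
    have inj1: "\<forall>i\<in>{0..n-1}. \<forall>j\<in>{0..n-1}.
        2 * (of_nat i / of_nat n - of_nat j / of_nat n) \<in> period_lattice \<tau> \<longrightarrow> i = j"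
    proof (intro ballI impI)
      fix i j assume that: "i \<in> {0..n-1}" "j \<in> {0..n-1}"
        "2 * (of_nat i / of_nat n - of_nat j / of_nat n) \<in> period_lattice \<tau>"
      have "2 * (of_nat i / of_nat n - of_nat j / of_nat n) =
              (of_int (2 * (int i - int j)) + of_int 0 * \<tau>) / of_nat n"
        using n by (simp add: field_simps)
      with that(3) have "int n dvd 2 * (int i - int j)"
        using period_lattice_div_iff[OF \<tau> n] by metis
      thus "i = j" using eq_if_odd_dvd_double_diff[OF True] that n by auto
    qed
    \<comment> \<open>For the second formula both lattices coincide, and the shifts are all
      \<open>n\<close>-division points of one period parallelogram.\<close>
    define t where "t = (\<lambda>(k, j). of_nat k / of_nat n + of_nat j * \<tau> / of_nat n)"
    have cosets2: "of_nat n * z \<in> period_lattice \<tau> \<longleftrightarrow>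
        (\<exists>p\<in>J. z + t p \<in> period_lattice \<tau>)" for z
    proof
      assume "of_nat n * z \<in> period_lattice \<tau>"
      then obtain a b :: int where ab: "of_nat n * z = of_int a + of_int b * \<tau>"
        unfolding period_lattice_def by blast
      obtain k where k: "k < n" "int n dvd a + int k" using ex_nat_less_int_dvd_add[OF n] by blast
      obtain j where j: "j < n" "int n dvd b + int j" using ex_nat_less_int_dvd_add[OF n] by blast
      have "z + t (k, j) = (of_int (a + int k) + of_int (b + int j) * \<tau>) / of_nat n"
        using ab n by (simp add: t_def field_simps)
      also have "\<dots> \<in> period_lattice \<tau>"
        unfolding period_lattice_div_iff[OF \<tau> n] using k j by simp
      finally show "\<exists>p\<in>J. z + t p \<in> period_lattice \<tau>"
        using k j by (intro bexI[of _ "(k, j)"]) (auto simp: J_def)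
    next
      assume "\<exists>p\<in>J. z + t p \<in> period_lattice \<tau>"
      then obtain k j and a b :: int
        where "z + t (k, j) = of_int a + of_int b * \<tau>"
        unfolding period_lattice_def by fast
      hence "of_nat n * z = of_int (int n * a - int k) + of_int (int n * b - int j) * \<tau>"
        using n by (simp add: t_def field_simps)
      thus "of_nat n * z \<in> period_lattice \<tau>"
        unfolding period_lattice_def by blast
    qed
    have inj2: "\<forall>p\<in>J. \<forall>q\<in>J. 2 * (t p - t q) \<in> period_lattice \<tau> \<longrightarrow> p = q"
    proof (intro ballI impI)
      fix p q assume that: "p \<in> J" "q \<in> J" "2 * (t p - t q) \<in> period_lattice \<tau>"
      obtain k j k' j' where pq: "p = (k, j)" "q = (k', j')" by force
      have "2 * (t p - t q) =
              (of_int (2 * (int k - int k')) + of_int (2 * (int j - int j')) * \<tau>) / of_nat n"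
        using n by (simp add: t_def pq field_simps)
      with that(3) have "int n dvd 2 * (int k - int k')" "int n dvd 2 * (int j - int j')"
        using period_lattice_div_iff[OF \<tau> n] by metis+
      thus "p = q" using eq_if_odd_dvd_double_diff[OF True] that n by (auto simp: pq J_def)
    qed
    have I1: "finite {0..n-1}" "0 \<in> {0..n-1}" "of_nat 0 / of_nat n = (0 :: complex)" by auto
    \<comment> \<open>Removing the trivial index leaves the index range of \<open>P\<close>.\<close>
    have "{0..n-1} - {0} = {1..n-1}" by auto
    note * = wp_z_scale_eq_prod[OF \<tau> n\<tau> n I1 cosets1 inj1, unfolded this, folded P_def]
    have I2: "finite J" "(0, 0) \<in> J" "t (0, 0) = 0" by (auto simp: J_def t_def)
    have Q: "(\<Prod>p\<in>J-{(0, 0)}. wp_z (t p) \<tau>) = Q"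
      unfolding Q_def J by (intro prod.cong) (auto simp: t_def)
    note ** = wp_z_scale_eq_prod[OF \<tau> \<tau> n I2 cosets2 inj2, unfolded Q]
    have prod_J: "(\<Prod>p\<in>J. wp_z (z + t p) \<tau>) = (\<Prod>k=0..n-1. \<Prod>j=0..n-1.
                   wp_z (z + of_nat k / of_nat n + of_nat j * \<tau> / of_nat n) \<tau>)" for z
      unfolding J_def by (simp add: prod.cartesian_product t_def case_prod_unfold add.assoc)
    show ?thesis
      unfolding Let_def P_def[symmetric] Q_def[symmetric]
    proof (intro conjI impI allI)
      show "\<exists>C. inverse C = of_nat n ^ 3 * Q \<and>
              (\<forall>z. of_nat n * z \<notin> period_lattice \<tau> \<longrightarrow>
                 wp_z (of_nat n * z) \<tau> =
                   C * (\<Prod>k=0..n-1. \<Prod>j=0..n-1.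
                          wp_z (z + of_nat k / of_nat n + of_nat j * \<tau> / of_nat n) \<tau>))"
      proof (intro exI[of _ "1 / (of_nat n ^ 3 * Q)"] conjI allI impI)
        fix z assume z: "of_nat n * z \<notin> period_lattice \<tau>"
        show "wp_z (of_nat n * z) \<tau> = 1 / (of_nat n ^ 3 * Q) * (\<Prod>k=0..n-1. \<Prod>j=0..n-1.
                wp_z (z + of_nat k / of_nat n + of_nat j * \<tau> / of_nat n) \<tau>)"
          using **(2)[OF z] unfolding prod_J .
      qed simp
    next
      show "P \<noteq> 0" by (rule *(1))
      show "Q \<noteq> 0" by (rule **(1))
    next
      fix z assume "of_nat n * z \<notin> period_lattice (of_nat n * \<tau>)"
      thus "wp_z (of_nat n * z) (of_nat n * \<tau>) =
              1 / (of_nat n ^ 3 * P) * (\<Prod>k=0..n-1. wp_z (z + of_nat k / of_nat n) \<tau>)"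
        by (rule *(2))
    qed
  qed
qed

end
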